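(* Let $Q$ be a balanced quiver whose block quiver $Q_b$ has three vertices. If $Q_b$ satisfies conditions (1) to (7) (listed in the context) for some vertex $m_1$, then $Q_b$ is the block quiver of a Fano triangle. Conversely, if $Q_b$ is the block quiver of a Fano triangle, then there is a vertex $m_1$ for which conditions (1) to (7) are satisfied.
   Context: Quivers. All quivers have finitely many vertices and arrows. A decorated quiver is a quiver with no self-loops or $2$-cycles each of whose vertices $v$ carries a label $(w_v,\ell_v)\in\mathbb{Z}^2$. $\mathrm{a}(x,y)$ is the signed number of arrows between $x$ and $y$: positive if arrows point from $x$ to $y$, negative if from $y$ to $x$, zero if there are none. $\mathrm{out}(m)$ (resp. $\mathrm{in}(m)$) is the set of vertices receiving an arrow from (resp. sending an arrow to) $m$. A decorated quiver is balanced if $\sum_{h\in\mathrm{out}(m)}w_h\mathrm{a}(m,h)=\sum_{t\in\mathrm{in}(m)}w_t\mathrm{a}(t,m)$ for every vertex $m$. The block quiver $Q_b$ of a decorated quiver $Q$ has as vertices the equivalence classes of vertices of $Q$ under: $m\sim m'$ iff $\ell_m=\ell_{m'}$, $\mathrm{in}(m)=\mathrm{in}(m')$, $\mathrm{out}(m)=\mathrm{out}(m')$ and $\mathrm{a}(x,m)=\mathrm{a}(x,m')$ for all $x\in\mathrm{in}(m)\cup\mathrm{out}(m)$. The class $\{m_1,\dots,m_k\}$ has label $(w_{m_1}+\dots+w_{m_k},\ell)$, where $\ell$ is the common second label, and signed arrow numbers in $Q_b$ are those between representatives. The block quiver of a balanced quiver is balanced. Fano triangles. Let $N$ be an oriented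 lattice of rank $2$, $M=\mathrm{Hom}(N,\mathbb{Z})$. Using an orientation-preserving isomorphism $N\cong\mathbb{Z}^2$ and dual coordinates on $M$, put $\det((a,b)^t,(c,d)^t)=ad-bc$ on $M$. A Fano polygon $P\subset N_{\mathbb{Q}}$ is a $2$-dimensional lattice polytope containing the origin in its strict interior with all vertices primitive; a Fano triangle is one with three vertices. $\Sigma_P$ is the fan of cones over the proper faces of $P$. For a maximal cone $\sigma$ with primitive generators $u,v$, $m_\sigma\in M$ is the primitive vector with $\langle m_\sigma,u\rangle=\langle m_\sigma,v\rangle<0$, $\ell_\sigma=-\langle m_\sigma,u\rangle$ and $w_\sigma=|\mathrm{conv}\{u,v\}\cap N|-1$. The block quiver of $P$ is $\mathbf{bquiv}(N,P)$, with vertex set $\{m_\sigma\mid\sigma\text{ maximal in }\Sigma_P\}$, labels $(w_\sigma,\ell_\sigma)$ and signed arrow numbers $\mathrm{a}(m_\sigma,m_\tau)=\det(m_\sigma,m_\tau)$. "$Q_b$ is the block quiver of a Fano triangle" means that $Q_b\cong\mathbf{bquiv}(N,P)$ as decorated quivers for some Fano triangle $P$. Conditions, relative to a chosen vertex $m_1$ of $Q_b$: (1) $Q_b$ is cyclic: its vertices can be labelled $m_1,m_2,m_3$ (starting with the chosen $m_1$) so that $\mathrm{a}(m_1,m_2),\mathrm{a}(m_2,m_3),\mathrm{a}(m_3,m_1)\ge1$. Let $(w_i,\ell_i)$ be the label of $m_i$. (2) $w_i,\ell_i\ge1$ for $i=1,2,3$. Define $y_1=-\ell_1$, $y_2=-\ell_1$,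 $y_3=y_2+w_2\,\mathrm{a}(m_1,m_2)$. (3) $y_3>0$. (4) There exists $x\in\mathbb{Z}$ with $\gcd\{x,y_1\}=\gcd\{x+w_1,y_2\}=1$, such that, for this $x$, conditions (5)–(7) below hold for the following rational numbers (indices modulo $3$): $x_1=x$, $x_2=x+w_1$, $x_3=(w_3\ell_3+x_1y_3)/y_1$, $x_3'=(x_2y_3-w_2\ell_2)/y_2$, and, for $j=2,3$, $s_j=-\mathrm{a}(m_1,m_j)$, $t_j=(x_{j+1}-x_j)/w_j$. (5) $t_2,t_3\in\mathbb{Z}$. (6) $x_3=x_3'$. (7) $\gcd\{x_3,y_3\}=\gcd\{s_j,t_j\}=1$ for $j=2,3$. *)

theory Defs
  imports "HOL-Analysis.Analysis" "Graph_Theory.Digraph_Isomorphism"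
begin

section \<open>Decorated quivers\<close>

record ('v, 'e) decorated_quiver =
  quiver :: "('v, 'e) pre_digraph"
  wlabel :: "'v \<Rightarrow> int"
  llabel :: "'v \<Rightarrow> int"

abbreviation qverts :: "('v, 'e) decorated_quiver \<Rightarrow> 'v set" where
  "qverts Q \<equiv> verts (quiver Q)"

definition is_decorated_quiver :: "('v, 'e) decorated_quiver \<Rightarrow> bool" where
  "is_decorated_quiver Q \<longleftrightarrow>
     fin_digraph (quiver Q) \<and> loopfree_digraph (quiver Q) \<and>
     (\<forall>x y. x \<rightarrow>\<^bsub>quiver Q\<^esub> y \<longrightarrow> \<not> y \<rightarrow>\<^bsub>quiver Q\<^esub> x)"

definition signed_arrows :: "('v, 'e) decorated_quiver \<Rightarrow> 'v \<Rightarrow> 'v \<Rightarrow> int" where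
  "signed_arrows Q x y =
     int (card (out_arcs (quiver Q) x \<inter> in_arcs (quiver Q) y)) -
     int (card (out_arcs (quiver Q) y \<inter> in_arcs (quiver Q) x))"

definition out_nbrs :: "('v, 'e) decorated_quiver \<Rightarrow> 'v \<Rightarrow> 'v set" where
  "out_nbrs Q m = {h. m \<rightarrow>\<^bsub>quiver Q\<^esub> h}"

definition in_nbrs :: "('v, 'e) decorated_quiver \<Rightarrow> 'v \<Rightarrow> 'v set" where
  "in_nbrs Q m = {t. t \<rightarrow>\<^bsub>quiver Q\<^esub> m}"

definition balanced :: "('v, 'e) decorated_quiver \<Rightarrow> bool" where
  "balanced Q \<longleftrightarrow> (\<forall>m \<in> qverts Q.
     (\<Sum>h \<in> out_nbrs Q m. wlabel Q h * signed_arrows Q m h) =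
     (\<Sum>t \<in> in_nbrs Q m. wlabel Q t * signed_arrows Q t m))"

text \<open>The third component of an arrow numbers the parallel arrows. For \<open>a\<close>
  skew-symmetric on a finite set \<open>V\<close>, this is a quiver without self-loops and
  2-cycles whose signed arrow numbers are given by \<open>a\<close>.\<close>

definition quiver_of :: "'v set \<Rightarrow> ('v \<Rightarrow> 'v \<Rightarrow> int) \<Rightarrow> ('v, 'v \<times> 'v \<times> nat) pre_digraph" where
  "quiver_of V a =
     \<lparr> verts = V,
       arcs = {(x, y, i). x \<in> V \<and> y \<in> V \<and> int i < a x y},
       tail = (\<lambda>(x, y, i). x),
       head = (\<lambda>(x, y, i). y) \<rparr>"

definition decorated_quiver_iso ::
  "('v, 'e) decorated_quiver \<Rightarrow> ('w, 'f) decorated_quiver \<Rightarrow> bool" where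
  "decorated_quiver_iso Q R \<longleftrightarrow>
     (\<exists>f. pre_digraph.digraph_isomorphism (quiver Q) f \<and>
          quiver R = app_iso f (quiver Q) \<and>
          (\<forall>v \<in> qverts Q. wlabel R (iso_verts f v) = wlabel Q v \<and>
                          llabel R (iso_verts f v) = llabel Q v))"


section \<open>The block quiver of a decorated quiver\<close>

definition block_rel :: "('v, 'e) decorated_quiver \<Rightarrow> ('v \<times> 'v) set" where
  "block_rel Q = {(m, m'). m \<in> qverts Q \<and> m' \<in> qverts Q \<and>
     llabel Q m = llabel Q m' \<and> in_nbrs Q m = in_nbrs Q m' \<and> out_nbrs Q m = out_nbrs Q m' \<and>
     (\<forall>x \<in> in_nbrs Q m \<union> out_nbrs Q m. signed_arrows Q x m = signed_arrows Q x m')}"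

definition rep :: "'v set \<Rightarrow> 'v" where
  "rep X = (SOME x. x \<in> X)"

definition block_quiver ::
  "('v, 'e) decorated_quiver \<Rightarrow> ('v set, 'v set \<times> 'v set \<times> nat) decorated_quiver" where
  "block_quiver Q =
     \<lparr> quiver = quiver_of (qverts Q // block_rel Q)
                  (\<lambda>X Y. signed_arrows Q (rep X) (rep Y)),
       wlabel = (\<lambda>X. \<Sum>m \<in> X. wlabel Q m),
       llabel = (\<lambda>X. llabel Q (rep X)) \<rparr>"


section \<open>Fano triangles and their block quivers\<close>

text \<open>An oriented lattice \<open>N\<close> of rank 2 is given by a positively oriented basis \<open>B\<close>; it
  spans the real plane, which plays the role of its scalar extension. Bases related by an
  integral base change of determinant 1 define the same oriented lattice, and all notions below
  take the same value on them. The dual lattice \<open>M\<close> consists of the linear functionals that are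
  integral on \<open>N\<close>.\<close>

type_synonym oriented_lattice = "(real ^ 2) \<times> (real ^ 2)"

type_synonym dual_vec = "(real ^ 2) \<Rightarrow>\<^sub>L real"

definition is_oriented_lattice :: "oriented_lattice \<Rightarrow> bool" where
  "is_oriented_lattice B \<longleftrightarrow> fst B \<noteq> snd B \<and> independent {fst B, snd B}"

definition latN :: "oriented_lattice \<Rightarrow> (real ^ 2) set" where
  "latN B = {of_int a *\<^sub>R fst B + of_int b *\<^sub>R snd B | a b :: int. True}"

definition latM :: "oriented_lattice \<Rightarrow> dual_vec set" where
  "latM B = {m. \<forall>n \<in> latN B. blinfun_apply m n \<in> \<int>}"

definition primitive_in :: "'a::real_vector set \<Rightarrow> 'a \<Rightarrow> bool" where
  "primitive_in L v \<longleftrightarrow> v \<in> L \<and> v \<noteq> 0 \<and>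
     (\<forall>k::int. \<forall>w \<in> L. v = of_int k *\<^sub>R w \<longrightarrow> \<bar>k\<bar> = 1)"

text \<open>The determinant in the coordinates on \<open>M\<close> dual to the basis \<open>B\<close>; the rounding is
  vacuous, as the argument is an integer for \<open>m\<close>, \<open>m'\<close> in \<open>M\<close>.\<close>

definition detM :: "oriented_lattice \<Rightarrow> dual_vec \<Rightarrow> dual_vec \<Rightarrow> int" where
  "detM B m m' =
     \<lfloor>blinfun_apply m (fst B) * blinfun_apply m' (snd B) -
      blinfun_apply m (snd B) * blinfun_apply m' (fst B)\<rfloor>"

definition fano_polygon :: "oriented_lattice \<Rightarrow> (real ^ 2) set \<Rightarrow> bool" where
  "fano_polygon B P \<longleftrightarrow>
     (\<exists>S. finite S \<and> S \<subseteq> latN B \<and> P = convex hull S) \<and> aff_dim P = 2 \<and> 0 \<in> interior P \<and>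
     (\<forall>v. v extreme_point_of P \<longrightarrow> primitive_in (latN B) v)"

definition fano_triangle :: "oriented_lattice \<Rightarrow> (real ^ 2) set \<Rightarrow> bool" where
  "fano_triangle B P \<longleftrightarrow> fano_polygon B P \<and> card {v. v extreme_point_of P} = 3"

text \<open>The empty face contributes the cone \<open>{0}\<close>.\<close>

definition spanning_fan :: "(real ^ 2) set \<Rightarrow> (real ^ 2) set set" where
  "spanning_fan P = {convex_cone hull F | F. F face_of P \<and> F \<noteq> P}"

definition maximal_cones :: "(real ^ 2) set \<Rightarrow> (real ^ 2) set set" where
  "maximal_cones P = {\<sigma> \<in> spanning_fan P. \<forall>\<tau> \<in> spanning_fan P. \<sigma> \<subseteq> \<tau> \<longrightarrow> \<sigma> = \<tau>}"

text \<open>The primitive generators of a cone are determined up to order; an order is chosen, but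
  nothing below depends on it.\<close>

definition prim_gens :: "oriented_lattice \<Rightarrow> (real ^ 2) set \<Rightarrow> (real ^ 2) \<times> (real ^ 2)" where
  "prim_gens B \<sigma> = (SOME (u, v). u \<noteq> v \<and> primitive_in (latN B) u \<and> primitive_in (latN B) v \<and>
                                 \<sigma> = convex_cone hull {u, v})"

definition cone_m :: "oriented_lattice \<Rightarrow> (real ^ 2) set \<Rightarrow> dual_vec" where
  "cone_m B \<sigma> = (let (u, v) = prim_gens B \<sigma> in
     THE m. primitive_in (latM B) m \<and> blinfun_apply m u = blinfun_apply m v \<and>
            blinfun_apply m u < 0)"

definition cone_l :: "oriented_lattice \<Rightarrow> (real ^ 2) set \<Rightarrow> int" where
  "cone_l B \<sigma> = \<lfloor>- blinfun_apply (cone_m B \<sigma>) (fst (prim_gens B \<sigma>))\<rfloor>"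

definition cone_w :: "oriented_lattice \<Rightarrow> (real ^ 2) set \<Rightarrow> int" where
  "cone_w B \<sigma> = (let (u, v) = prim_gens B \<sigma> in int (card (convex hull {u, v} \<inter> latN B)) - 1)"

text \<open>Distinct maximal cones \<open>\<sigma>\<close> have distinct vectors \<open>cone_m B \<sigma>\<close>, so the labels of a vertex
  are those of the unique maximal cone it comes from.\<close>

definition bquiv ::
  "oriented_lattice \<Rightarrow> (real ^ 2) set \<Rightarrow>
     (dual_vec, dual_vec \<times> dual_vec \<times> nat) decorated_quiver" where
  "bquiv B P =
     (let cone_of = the_inv_into (maximal_cones P) (cone_m B) in
      \<lparr> quiver = quiver_of (cone_m B ` maximal_cones P) (detM B),
        wlabel = (\<lambda>m. cone_w B (cone_of m)),
        llabel = (\<lambda>m. cone_l B (cone_of m)) \<rparr>)"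

definition is_block_quiver_of_fano_triangle ::
  "oriented_lattice \<Rightarrow> ('v, 'e) decorated_quiver \<Rightarrow> bool" where
  "is_block_quiver_of_fano_triangle B R \<longleftrightarrow>
     (\<exists>P. fano_triangle B P \<and> decorated_quiver_iso R (bquiv B P))"


section \<open>The numerical conditions\<close>

text \<open>\<open>gcd {r, s} = 1\<close> for rational numbers, including the requirement that both are integers.\<close>

definition rat_coprime :: "rat \<Rightarrow> rat \<Rightarrow> bool" where
  "rat_coprime r s \<longleftrightarrow> (\<exists>a b :: int. r = of_int a \<and> s = of_int b \<and> gcd a b = 1)"

text \<open>Here \<open>a12\<close>, \<open>a13\<close> stand for \<open>a(m\<^sub>1, m\<^sub>2)\<close>, \<open>a(m\<^sub>1, m\<^sub>3)\<close>. As indices are modulo 3,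
  \<open>t\<^sub>3\<close> is formed with \<open>x\<^sub>4 = x\<^sub>1\<close>.\<close>

definition numerical_conditions ::
  "int \<Rightarrow> int \<Rightarrow> int \<Rightarrow> int \<Rightarrow> int \<Rightarrow> int \<Rightarrow> int \<Rightarrow> int \<Rightarrow> bool" where
  "numerical_conditions w1 w2 w3 l1 l2 l3 a12 a13 \<longleftrightarrow>
     (let y1 = - l1; y2 = - l1; y3 = y2 + w2 * a12 in
      y3 > 0 \<and>
      (\<exists>x :: int.
         gcd x y1 = 1 \<and> gcd (x + w1) y2 = 1 \<and>
         (let x1 = (of_int x :: rat);
              x2 = (of_int (x + w1) :: rat);
              x3 = (of_int (w3 * l3) + x1 * of_int y3) / of_int y1;
              x3' = (x2 * of_int y3 - of_int (w2 * l2)) / of_int y2;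
              s2 = - a12;
              s3 = - a13;
              t2 = (x3 - x2) / of_int w2;
              t3 = (x1 - x3) / of_int w3
          in t2 \<in> \<int> \<and> t3 \<in> \<int> \<and>
             x3 = x3' \<and>
             rat_coprime x3 (of_int y3) \<and>
             rat_coprime (of_int s2) t2 \<and> rat_coprime (of_int s3) t3)))"

definition triangle_conditions :: "('v, 'e) decorated_quiver \<Rightarrow> 'v \<Rightarrow> bool" where
  "triangle_conditions R m1 \<longleftrightarrow>
     (\<exists>m2 m3.
        distinct [m1, m2, m3] \<and> qverts R = {m1, m2, m3} \<and>
        signed_arrows R m1 m2 \<ge> 1 \<and> signed_arrows R m2 m3 \<ge> 1 \<and> signed_arrows R m3 m1 \<ge> 1 \<and>
        (\<forall>m \<in> {m1, m2, m3}. wlabel R m \<ge> 1 \<and> llabel R m \<ge> 1) \<and>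
        numerical_conditions (wlabel R m1) (wlabel R m2) (wlabel R m3)
          (llabel R m1) (llabel R m2) (llabel R m3)
          (signed_arrows R m1 m2) (signed_arrows R m1 m3))"

end

(* A maximal cone of a Fano triangle lies over an edge from v to v + w d with d primitive, and the
   determinant form D of the lattice identifies m with D(d, -). Hence a(m, m') = D(d, d') and
   l = D(v, d). In the lattice basis (d1, e) with D(d1, e) = 1, the coordinates (x, y) of the three
   vertices, and those of the edge directions, are the numbers in conditions (1) to (7). Conversely,
   these numbers define a triangle; balancing at m1 says that it closes up, and balancing at m2 that
   a(m2, m3) has the right value. *)

theory Submission
  imports Defs
begin

section \<open>Signed arrow numbers, isomorphisms and balancing\<close>

text \<open>The list (3) to (7) never mentions a(m2, m3) and meets a(m1, m3) only in a coprimality;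
  balancing supplies the missing links w3 a(m1, m3) = y1 - y3 and w3 a(m2, m3) = w1 a(m1, m2). The
  two formulas for x3 come from w3 l3 = D(v3, v1) and w2 l2 = D(v2, v3), the doubled areas of the
  triangles spanned by the origin and an edge, written in coordinates and solved for x3. The first
  edge is horizontal at height y1 = y2 = -l1. The integer x in (4) is existential because e is
  determined only up to multiples of d1: replacing e by e + k d1 replaces each x_i by x_i - k y_i.
  All signs rest on listing the vertices counterclockwise for D, which is possible because the
  origin is an interior point. On the geometric side the obstacle is that generators, m_sigma and
  the labels of a vertex are given by choice, description and inverse operators, so each needs a
  uniqueness argument before it can be computed.\<close>

lemma signed_arrows_swap: "signed_arrows Q y x = - signed_arrows Q x y"
  by (simp add: signed_arrows_def)

text \<open>There are \<open>nat (a x y)\<close> arrows from \<open>x\<close> to \<open>y\<close>.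
  Truncation loses nothing: skew-symmetry makes the opposite count \<open>nat (- a x y)\<close>, and
  the difference of the two is \<open>a x y\<close>.\<close>

lemma signed_arrows_quiver_of:
  assumes "quiver R = quiver_of V a" "x \<in> V" "y \<in> V" "a y x = - a x y"
  shows "signed_arrows R x y = a x y"
proof -
  have arrows: "card (out_arcs (quiver R) x \<inter> in_arcs (quiver R) y) = nat (a x y)"
    if "x \<in> V" "y \<in> V" for x y
  proof -
    have "out_arcs (quiver R) x \<inter> in_arcs (quiver R) y = (\<lambda>i. (x, y, i)) ` {..<nat (a x y)}"
      using that by (auto simp: assms(1) quiver_of_def zless_nat_eq_int_zless)
    then show ?thesis
      by (simp add: card_image inj_on_def)
  qed
  show ?thesis
    using assms(4) by (simp add: signed_arrows_def arrows assms(2,3))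
qed

lemma signed_arrows_app_iso:
  assumes iso: "pre_digraph.digraph_isomorphism (quiver R) \<phi>"
    and R': "quiver R' = app_iso \<phi> (quiver R)"
    and "x \<in> qverts R" "y \<in> qverts R"
  shows "signed_arrows R' (iso_verts \<phi> x) (iso_verts \<phi> y) = signed_arrows R x y"
proof -
  have wf: "wf_digraph (quiver R)"
    and injv: "inj_on (iso_verts \<phi>) (qverts R)" and inja: "inj_on (iso_arcs \<phi>) (arcs (quiver R))"
    and ends: "\<And>e. e \<in> arcs (quiver R) \<Longrightarrow>
      iso_tail \<phi> (iso_arcs \<phi> e) = iso_verts \<phi> (tail (quiver R) e) \<and>
      iso_head \<phi> (iso_arcs \<phi> e) = iso_verts \<phi> (head (quiver R) e)"
    using iso by (auto simp: pre_digraph.digraph_isomorphism_def)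
  have arrows: "card (out_arcs (quiver R') (iso_verts \<phi> x) \<inter> in_arcs (quiver R') (iso_verts \<phi> y)) =
      card (out_arcs (quiver R) x \<inter> in_arcs (quiver R) y)"
    if "x \<in> qverts R" "y \<in> qverts R" for x y
  proof -
    have "out_arcs (quiver R') (iso_verts \<phi> x) \<inter> in_arcs (quiver R') (iso_verts \<phi> y) =
        iso_arcs \<phi> ` (out_arcs (quiver R) x \<inter> in_arcs (quiver R) y)"
    proof (intro set_eqI iffI)
      fix e
      assume "e \<in> out_arcs (quiver R') (iso_verts \<phi> x) \<inter> in_arcs (quiver R') (iso_verts \<phi> y)"
      then obtain e' where e': "e' \<in> arcs (quiver R)" "e = iso_arcs \<phi> e'"
        and "iso_tail \<phi> e = iso_verts \<phi> x" "iso_head \<phi> e = iso_verts \<phi> y"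
        by (auto simp: R')
      \<comment> \<open>\<open>iso_verts\<close> is injective only on vertices, so well-formedness
        is needed to know that the ends of \<open>e'\<close> are vertices.\<close>
      then have "tail (quiver R) e' = x" "head (quiver R) e' = y"
        using ends[OF e'(1)] wf_digraph.tail_in_verts[OF wf e'(1)]
          wf_digraph.head_in_verts[OF wf e'(1)] that
        by (auto dest: inj_onD[OF injv])
      then show "e \<in> iso_arcs \<phi> ` (out_arcs (quiver R) x \<inter> in_arcs (quiver R) y)"
        using e' by auto
    next
      fix e
      assume "e \<in> iso_arcs \<phi> ` (out_arcs (quiver R) x \<inter> in_arcs (quiver R) y)"
      then show "e \<in> out_arcs (quiver R') (iso_verts \<phi> x) \<inter> in_arcs (quiver R') (iso_verts \<phi> y)"
        using ends by (auto simp: R')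
    qed
    moreover have "inj_on (iso_arcs \<phi>) (out_arcs (quiver R) x \<inter> in_arcs (quiver R) y)"
      by (rule inj_on_subset[OF inja]) auto
    ultimately show ?thesis
      by (simp add: card_image)
  qed
  show ?thesis
    by (simp add: signed_arrows_def arrows assms(3,4))
qed

text \<open>Since parallel arrows are numbered from 0 upwards, a vertex bijection that preserves
  \<open>a\<close> lifts to arrows by keeping the number. Isomorphism of decorated quivers thus
  becomes a statement about integers attached to vertices.\<close>

lemma decorated_quiver_iso_quiver_of:
  assumes R: "quiver R = quiver_of V a" and skew: "\<And>x y. x \<in> V \<Longrightarrow> y \<in> V \<Longrightarrow> a y x = - a x y"
    and R': "quiver R' = quiver_of V' a'"
    and skew': "\<And>x y. x \<in> V' \<Longrightarrow> y \<in> V' \<Longrightarrow> a' y x = - a' x y"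
  shows "decorated_quiver_iso R R' \<longleftrightarrow>
    (\<exists>f. bij_betw f V V' \<and> (\<forall>x\<in>V. \<forall>y\<in>V. a' (f x) (f y) = a x y) \<and>
         (\<forall>x\<in>V. wlabel R' (f x) = wlabel R x \<and> llabel R' (f x) = llabel R x))"
proof
  have verts: "qverts R = V" "qverts R' = V'"
    by (simp_all add: R R' quiver_of_def)
  assume "decorated_quiver_iso R R'"
  then obtain \<phi> where iso: "pre_digraph.digraph_isomorphism (quiver R) \<phi>"
    and app: "quiver R' = app_iso \<phi> (quiver R)"
    and labels: "\<forall>v \<in> V. wlabel R' (iso_verts \<phi> v) = wlabel R v \<and>
                          llabel R' (iso_verts \<phi> v) = llabel R v"
    by (auto simp: decorated_quiver_iso_def verts)
  have bij: "bij_betw (iso_verts \<phi>) V V'"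
    using iso verts app by (auto simp: bij_betw_def pre_digraph.digraph_isomorphism_def)
  have "a' (iso_verts \<phi> x) (iso_verts \<phi> y) = a x y" if "x \<in> V" "y \<in> V" for x y
  proof -
    have V': "iso_verts \<phi> x \<in> V'" "iso_verts \<phi> y \<in> V'"
      using that bij_betwE[OF bij] by auto
    show ?thesis
      using signed_arrows_app_iso[OF iso app, of x y] that verts
        signed_arrows_quiver_of[of R V a x y, OF R that skew[OF that]]
        signed_arrows_quiver_of[of R' V' a', OF R' V' skew'[OF V']]
      by simp
  qed
  with bij labels show "\<exists>f. bij_betw f V V' \<and> (\<forall>x\<in>V. \<forall>y\<in>V. a' (f x) (f y) = a x y) \<and>
         (\<forall>x\<in>V. wlabel R' (f x) = wlabel R x \<and> llabel R' (f x) = llabel R x)"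
    by blast
next
  assume "\<exists>f. bij_betw f V V' \<and> (\<forall>x\<in>V. \<forall>y\<in>V. a' (f x) (f y) = a x y) \<and>
         (\<forall>x\<in>V. wlabel R' (f x) = wlabel R x \<and> llabel R' (f x) = llabel R x)"
  then obtain f where inj: "inj_on f V" and im: "f ` V = V'"
    and f: "\<And>x y. x \<in> V \<Longrightarrow> y \<in> V \<Longrightarrow> a' (f x) (f y) = a x y"
    and labels: "\<forall>x\<in>V. wlabel R' (f x) = wlabel R x \<and> llabel R' (f x) = llabel R x"
    by (auto simp: bij_betw_def)
  \<comment> \<open>\<open>app_iso\<close> installs \<open>iso_head\<close> and
    \<open>iso_tail\<close> as the head and tail functions of its result, and the records must be
    equal as total functions; hence exactly those of the target.\<close>
  define \<phi> where "\<phi> = \<lparr> iso_verts = f, iso_arcs = (\<lambda>(x, y, i). (f x, f y, i :: nat)),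
    iso_head = head (quiver_of V' a'), iso_tail = tail (quiver_of V' a') \<rparr>"
  have "wf_digraph (quiver_of V a)"
    by unfold_locales (auto simp: quiver_of_def)
  then have iso: "pre_digraph.digraph_isomorphism (quiver_of V a) \<phi>"
    using inj by (auto simp: pre_digraph.digraph_isomorphism_def \<phi>_def quiver_of_def inj_on_def)
  have "arcs (quiver_of V' a') = (\<lambda>(x, y, i). (f x, f y, i)) ` arcs (quiver_of V a)"
  proof (intro set_eqI iffI)
    fix e assume "e \<in> arcs (quiver_of V' a')"
    then obtain x y i where "x \<in> V" "y \<in> V" "e = (f x, f y, i)" "int i < a' (f x) (f y)"
      by (auto simp: quiver_of_def simp flip: im)
    then have "(x, y, i) \<in> arcs (quiver_of V a)" "e = (f x, f y, i)"
      by (simp_all add: quiver_of_def f)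
    then show "e \<in> (\<lambda>(x, y, i). (f x, f y, i)) ` arcs (quiver_of V a)"
      by force
  qed (auto simp: quiver_of_def f simp flip: im)
  then have "quiver_of V' a' = app_iso \<phi> (quiver_of V a)"
    using im by (intro pre_digraph.equality) (simp_all add: app_iso_def \<phi>_def quiver_of_def)
  then show "decorated_quiver_iso R R'"
    unfolding decorated_quiver_iso_def using iso labels
    by (intro exI[of _ \<phi>]) (simp add: R R' \<phi>_def quiver_of_def)
qed

section \<open>Block classes and the balancing relation\<close>

lemma equiv_block_rel: "equiv (qverts Q) (block_rel Q)"
  by (auto simp: equiv_def refl_on_def sym_def trans_def block_rel_def)

lemma rep_in:
  assumes "X \<in> A // r" "equiv A r"
  shows "rep X \<in> X"
  using in_quotient_imp_non_empty[OF assms(2,1)] by (simp add: rep_def some_in_eq)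

lemma signed_arrows_not_nbr:
  assumes "m \<notin> in_nbrs Q x \<union> out_nbrs Q x"
  shows "signed_arrows Q x m = 0"
proof -
  have "out_arcs (quiver Q) x \<inter> in_arcs (quiver Q) m = {}"
    "out_arcs (quiver Q) m \<inter> in_arcs (quiver Q) x = {}"
    using assms by (auto simp: in_nbrs_def out_nbrs_def arcs_ends_conv)
  then show ?thesis
    by (simp add: signed_arrows_def)
qed

text \<open>\<open>block_rel\<close> compares arrow numbers at neighbours only. Equivalent vertices
  have the same neighbours, and at any other vertex both numbers vanish.\<close>

lemma signed_arrows_block_rel:
  assumes "(m, m') \<in> block_rel Q"
  shows "signed_arrows Q x m = signed_arrows Q x m'"
proof (cases "x \<in> in_nbrs Q m \<union> out_nbrs Q m")
  case True
  then show ?thesis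
    using assms by (auto simp: block_rel_def)
next
  case False
  then have "x \<notin> in_nbrs Q m' \<union> out_nbrs Q m'"
    using assms by (auto simp: block_rel_def)
  with False have "signed_arrows Q m x = 0" "signed_arrows Q m' x = 0"
    by (simp_all add: signed_arrows_not_nbr)
  then show ?thesis
    by (simp add: signed_arrows_swap[of Q x m] signed_arrows_swap[of Q x m'])
qed

text \<open>Moving the incoming sum across by skew-symmetry turns balancing into one linear relation
  over all vertices, a form that passes to classes. The absence of 2-cycles keeps the two neighbour
  sets disjoint.\<close>

lemma balanced_imp_sum_eq_0:
  assumes Q: "is_decorated_quiver Q" and "balanced Q" "x \<in> qverts Q"
  shows "(\<Sum>m\<in>qverts Q. wlabel Q m * signed_arrows Q x m) = 0"
proof -
  have fin: "fin_digraph (quiver Q)"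
    and no2: "\<And>x y. x \<rightarrow>\<^bsub>quiver Q\<^esub> y \<Longrightarrow> \<not> y \<rightarrow>\<^bsub>quiver Q\<^esub> x"
    using Q by (auto simp: is_decorated_quiver_def)
  interpret fin_digraph "quiver Q" by (rule fin)
  let ?g = "\<lambda>m. wlabel Q m * signed_arrows Q x m"
  have sub: "out_nbrs Q x \<union> in_nbrs Q x \<subseteq> qverts Q"
    by (auto simp: out_nbrs_def in_nbrs_def dest: adj_in_verts)
  have "(\<Sum>m\<in>qverts Q. ?g m) = (\<Sum>m\<in>out_nbrs Q x \<union> in_nbrs Q x. ?g m)"
    using sub signed_arrows_not_nbr[of _ Q x]
    by (intro sum.mono_neutral_right) auto
  also have "\<dots> = (\<Sum>m\<in>out_nbrs Q x. ?g m) + (\<Sum>m\<in>in_nbrs Q x. ?g m)"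
  proof (rule sum.union_disjoint)
    show "finite (out_nbrs Q x)" "finite (in_nbrs Q x)"
      using sub finite_subset[OF _ finite_verts] by simp_all
    show "out_nbrs Q x \<inter> in_nbrs Q x = {}"
      using no2 by (auto simp only: out_nbrs_def in_nbrs_def)
  qed
  also have "(\<Sum>m\<in>in_nbrs Q x. ?g m) = - (\<Sum>m\<in>in_nbrs Q x. wlabel Q m * signed_arrows Q m x)"
    by (simp add: signed_arrows_swap[of Q x] sum_negf)
  finally show ?thesis
    using assms(2,3) by (simp add: balanced_def)
qed

text \<open>The relation at \<open>rep X\<close> is summed class by class: arrow numbers from
  \<open>rep X\<close> are constant on a class, and the weights in a class add up to its
  label.\<close>

lemma block_quiver_balanced:
  assumes Q: "is_decorated_quiver Q" and "balanced Q" and X: "X \<in> qverts (block_quiver Q)"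
  shows "(\<Sum>Y\<in>qverts (block_quiver Q). wlabel (block_quiver Q) Y * signed_arrows Q (rep X) (rep Y)) = 0"
proof -
  let ?V = "qverts Q // block_rel Q"
  have verts: "qverts (block_quiver Q) = ?V"
    by (simp add: block_quiver_def quiver_of_def)
  have fin: "finite (qverts Q)"
    using Q by (auto simp: is_decorated_quiver_def fin_digraph_def fin_digraph_axioms_def)
  have Un: "\<Union>?V = qverts Q"
    by (rule Union_quotient[OF equiv_block_rel])
  have "rep X \<in> qverts Q"
    using rep_in[OF _ equiv_block_rel, of X Q] X verts Un by auto
  then have "0 = (\<Sum>m\<in>\<Union>?V. wlabel Q m * signed_arrows Q (rep X) m)"
    using balanced_imp_sum_eq_0[OF assms(1,2)] Un by simp
  also have "\<dots> = (\<Sum>Y\<in>?V. \<Sum>m\<in>Y. wlabel Q m * signed_arrows Q (rep X) m)"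
    using fin Un quotient_disj[OF equiv_block_rel, of _ Q]
    by (subst sum.Union_disjoint) (auto intro: finite_subset)
  also have "\<dots> = (\<Sum>Y\<in>?V. \<Sum>m\<in>Y. wlabel Q m * signed_arrows Q (rep X) (rep Y))"
  proof (intro sum.cong refl)
    fix Y m assume "Y \<in> ?V" "m \<in> Y"
    then have "(m, rep Y) \<in> block_rel Q"
      using rep_in[OF _ equiv_block_rel, of Y Q]
        in_quotient_imp_in_rel[OF equiv_block_rel, of Y Q m "rep Y"] by simp
    from signed_arrows_block_rel[OF this]
    show "wlabel Q m * signed_arrows Q (rep X) m = wlabel Q m * signed_arrows Q (rep X) (rep Y)"
      by simp
  qed
  finally show ?thesis
    by (simp add: verts) (simp add: block_quiver_def sum_distrib_right)
qed

section \<open>Primitive vectors and the determinant form\<close>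

locale plane_lattice =
  fixes B :: oriented_lattice
  assumes oriented_lattice: "is_oriented_lattice B"
begin

text \<open>The determinant in coordinates with respect to \<open>B\<close>. Dividing by the
  determinant of the basis makes the orientation that of \<open>B\<close>, even when it differs from
  the standard one of the plane.\<close>

definition D :: "real ^ 2 \<Rightarrow> real ^ 2 \<Rightarrow> real" where
  "D u v = (u $ 1 * v $ 2 - u $ 2 * v $ 1) / (fst B $ 1 * snd B $ 2 - fst B $ 2 * snd B $ 1)"

lemma basis_det_nonzero: "fst B $ 1 * snd B $ 2 - fst B $ 2 * snd B $ 1 \<noteq> 0"
proof
  assume 0: "fst B $ 1 * snd B $ 2 - fst B $ 2 * snd B $ 1 = 0"
  have ind: "independent {fst B, snd B}" "fst B \<noteq> snd B"
    using oriented_lattice by (auto simp: is_oriented_lattice_def)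
  then have nz: "snd B \<noteq> 0" and ns: "fst B \<notin> span {snd B}"
    using dependent_zero[of "{fst B, snd B}"] by (auto simp: independent_insert)
  from nz consider "snd B $ 1 \<noteq> 0" | "snd B $ 2 \<noteq> 0"
    by (auto simp: vec_eq_iff forall_2)
  then have "\<exists>k. fst B = k *\<^sub>R snd B"
  proof cases
    case 1
    then show ?thesis using 0
      by (intro exI[of _ "fst B $ 1 / snd B $ 1"]) (simp add: vec_eq_iff forall_2 field_simps)
  next
    case 2
    then show ?thesis using 0
      by (intro exI[of _ "fst B $ 2 / snd B $ 2"]) (simp add: vec_eq_iff forall_2 field_simps)
  qed
  then show False
    using ns by (auto simp: span_singleton)
qed

lemma D_add_left: "D (u + v) w = D u w + D v w"
  and D_add_right: "D w (u + v) = D w u + D w v"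
  and D_diff_left: "D (u - v) w = D u w - D v w"
  and D_diff_right: "D w (u - v) = D w u - D w v"
  and D_scaleR_left: "D (r *\<^sub>R u) v = r * D u v"
  and D_scaleR_right: "D u (r *\<^sub>R v) = r * D u v"
  and D_self: "D u u = 0"
  and D_zero_left: "D 0 u = 0"
  and D_zero_right: "D u 0 = 0"
  by (simp_all add: D_def algebra_simps add_divide_distrib diff_divide_distrib)

lemmas D_simps = D_add_left D_add_right D_diff_left D_diff_right D_scaleR_left D_scaleR_right
  D_self D_zero_left D_zero_right

lemma D_swap: "D v u = - D u v"
  by (simp add: D_def diff_divide_distrib algebra_simps)

lemma D_basis: "D (fst B) (snd B) = 1"
  using basis_det_nonzero by (simp add: D_def)

text \<open>Each component expands a 3 by 3 determinant with a repeated row. Later uses are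
  coordinates in a unimodular basis, nondegeneracy of \<open>D\<close>, and the position of the
  origin inside a triangle.\<close>

lemma cramer: "D v w *\<^sub>R u + D w u *\<^sub>R v + D u v *\<^sub>R w = 0"
proof -
  have "(v $ 1 * w $ 2 - v $ 2 * w $ 1) * u $ i + (w $ 1 * u $ 2 - w $ 2 * u $ 1) * v $ i
      + (u $ 1 * v $ 2 - u $ 2 * v $ 1) * w $ i = 0" for i
    using exhaust_2[of i] by (auto simp: algebra_simps)
  then show ?thesis
    by (simp add: vec_eq_iff D_def flip: add_divide_distrib)
qed

lemma D_expand:
  assumes "D v w = 1"
  shows "u = D u w *\<^sub>R v + D v u *\<^sub>R w"
proof -
  have "D w u *\<^sub>R v = - (D u w *\<^sub>R v)"
    by (simp add: D_swap[of w u])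
  then have "u - (D u w *\<^sub>R v + D v u *\<^sub>R w) = 0"
    using cramer[of v w u] assms D_swap[of u v] by (simp add: algebra_simps)
  then show ?thesis
    by simp
qed

lemma D_nondegenerate:
  assumes "D u v = 0" "D u w = 0" "D v w \<noteq> 0"
  shows "u = 0"
  using cramer[of v w u] assms D_swap[of w u] by simp

lemma latN_iff: "u \<in> latN B \<longleftrightarrow> D u (snd B) \<in> \<int> \<and> D (fst B) u \<in> \<int>"
proof
  assume "u \<in> latN B"
  then show "D u (snd B) \<in> \<int> \<and> D (fst B) u \<in> \<int>"
    by (auto simp: latN_def D_simps D_basis)
next
  assume "D u (snd B) \<in> \<int> \<and> D (fst B) u \<in> \<int>"
  then obtain a b where "D u (snd B) = of_int a" "D (fst B) u = of_int b"
    by (auto elim!: Ints_cases)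
  then have "u = of_int a *\<^sub>R fst B + of_int b *\<^sub>R snd B"
    using D_expand[OF D_basis, of u] by simp
  then show "u \<in> latN B"
    by (auto simp: latN_def)
qed

lemma latN_closed:
  shows latN_add: "u \<in> latN B \<Longrightarrow> v \<in> latN B \<Longrightarrow> u + v \<in> latN B"
    and latN_diff: "u \<in> latN B \<Longrightarrow> v \<in> latN B \<Longrightarrow> u - v \<in> latN B"
    and latN_scale: "u \<in> latN B \<Longrightarrow> of_int k *\<^sub>R u \<in> latN B"
    and latN_basis: "fst B \<in> latN B" "snd B \<in> latN B"
  by (auto simp: latN_iff D_simps D_basis)

lemma D_Ints:
  assumes "u \<in> latN B" "v \<in> latN B"
  shows "D u v \<in> \<int>"
proof -
  have "D u v = D u (snd B) * D (fst B) v - D (fst B) u * D v (snd B)"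
    by (subst D_expand[OF D_basis, of v]) (simp add: D_simps D_swap[of u "fst B"])
  then show ?thesis
    using assms by (simp add: latN_iff)
qed

lemma primitive_part:
  assumes "v \<in> latN B" "v \<noteq> 0"
  obtains k d w where "k > 0" "d \<in> latN B" "w \<in> latN B" "D d w = 1" "v = of_int k *\<^sub>R d"
proof -
  obtain a b :: int where v: "v = of_int a *\<^sub>R fst B + of_int b *\<^sub>R snd B"
    using assms by (auto simp: latN_def)
  define g where "g = gcd a b"
  have pos: "g > 0"
    using assms(2) v by (auto simp: g_def gcd_pos_int)
  obtain a' b' where ab: "a = g * a'" "b = g * b'"
    unfolding g_def by (metis dvdE gcd_dvd1 gcd_dvd2)
  obtain s t where st: "s * a + t * b = g"
    using bezout_int[of a b] by (auto simp: g_def)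
  have "g * (s * a' + t * b') = g * 1"
    using st by (simp add: ab algebra_simps)
  then have 1: "s * a' + t * b' = 1"
    using pos by (simp only: mult_cancel_left) simp
  \<comment> \<open>With Bezout coefficients \<open>s\<close>, \<open>t\<close> of the reduced
    coordinates, \<open>w\<close> has coordinates \<open>(- t, s)\<close>, which makes
    \<open>D d w\<close> equal to \<open>s * a' + t * b'\<close>, that is, to 1.\<close>
  define d w where "d = of_int a' *\<^sub>R fst B + of_int b' *\<^sub>R snd B"
    and "w = of_int s *\<^sub>R snd B - of_int t *\<^sub>R fst B"
  have "D d w = of_int (s * a' + t * b')"
    by (simp add: d_def w_def D_simps D_basis D_swap[of "snd B"])
  moreover have "d \<in> latN B" "w \<in> latN B"
    unfolding d_def w_def by (intro latN_closed)+
  moreover have "v = of_int g *\<^sub>R d"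
    by (simp add: d_def v ab scaleR_add_right)
  ultimately show ?thesis
    using that pos 1 by simp
qed

text \<open>The working form of primitivity: a partner \<open>w\<close> completes \<open>v\<close>
  to an oriented lattice basis. If \<open>v\<close> is \<open>k\<close> times a lattice vector,
  pairing with \<open>w\<close> exhibits \<open>k\<close> as a divisor of 1.\<close>

lemma primitive_latN_iff:
  "primitive_in (latN B) v \<longleftrightarrow> v \<in> latN B \<and> (\<exists>w\<in>latN B. D v w = 1)"
proof
  assume prim: "primitive_in (latN B) v"
  then obtain k d w where "k > 0" "d \<in> latN B" "w \<in> latN B" "D d w = 1" "v = of_int k *\<^sub>R d"
    using primitive_part[of v] by (auto simp: primitive_in_def)
  moreover from this prim have "\<bar>k\<bar> = 1"
    by (auto simp: primitive_in_def)
  ultimately show "v \<in> latN B \<and> (\<exists>w\<in>latN B. D v w = 1)"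
    by auto
next
  assume "v \<in> latN B \<and> (\<exists>w\<in>latN B. D v w = 1)"
  then obtain w where v: "v \<in> latN B" and w: "w \<in> latN B" "D v w = 1"
    by blast
  have "\<bar>k\<bar> = 1" if "u \<in> latN B" "v = of_int k *\<^sub>R u" for k u
  proof -
    from D_Ints[OF that(1) w(1)] obtain j where "D u w = of_int j"
      by (auto elim: Ints_cases)
    then have "of_int (k * j) = (1 :: real)"
      using w(2) that(2) by (simp add: D_simps)
    then have "k * j = 1"
      by linarith
    then show ?thesis
      by (auto simp: zmult_eq_1_iff)
  qed
  moreover have "v \<noteq> 0"
    using w(2) by (auto simp: D_simps)
  ultimately show "primitive_in (latN B) v"
    using v by (auto simp: primitive_in_def)
qed

text \<open>In the basis formed by \<open>d\<close> and a partner \<open>w\<close>, the only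
  coefficient left is \<open>D u w\<close>, an integer.\<close>

lemma primitive_parallel:
  assumes "primitive_in (latN B) d" "u \<in> latN B" "D d u = 0"
  obtains k where "u = of_int k *\<^sub>R d"
proof -
  obtain w where w: "w \<in> latN B" "D d w = 1"
    using assms(1) by (auto simp: primitive_latN_iff)
  have "u = D u w *\<^sub>R d"
    using D_expand[OF w(2), of u] assms(3) by simp
  moreover obtain k where "D u w = of_int k"
    using D_Ints[OF assms(2) w(1)] by (auto elim: Ints_cases)
  ultimately show ?thesis
    using that by metis
qed

section \<open>The dual lattice seen inside the lattice\<close>

definition dual_of :: "real ^ 2 \<Rightarrow> dual_vec" where
  "dual_of d = Blinfun (D d)"

lemma dual_of_apply: "blinfun_apply (dual_of d) u = D d u"
proof -
  have "linear (D d)"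
    by (intro linearI) (simp_all add: D_simps)
  then show ?thesis
    by (simp add: dual_of_def bounded_linear_Blinfun_apply linear_conv_bounded_linear)
qed

text \<open>A vector with coordinates \<open>(p, q)\<close> pairs to \<open>- q\<close> with
  \<open>fst B\<close> and to \<open>p\<close> with \<open>snd B\<close>; solving for
  \<open>p\<close> and \<open>q\<close> gives the preimage.\<close>

lemma dual_of_surj: "m = dual_of (blinfun_apply m (snd B) *\<^sub>R fst B - blinfun_apply m (fst B) *\<^sub>R snd B)"
proof (rule blinfun_eqI)
  fix u
  have "blinfun_apply m u = blinfun_apply m (D u (snd B) *\<^sub>R fst B + D (fst B) u *\<^sub>R snd B)"
    using D_expand[OF D_basis, of u] by simp
  then show "blinfun_apply m u =
      blinfun_apply (dual_of (blinfun_apply m (snd B) *\<^sub>R fst B - blinfun_apply m (fst B) *\<^sub>R snd B)) u"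
    by (simp add: dual_of_apply D_simps blinfun.add_right blinfun.scaleR_right D_swap[of "snd B" u] algebra_simps)
qed

lemma dual_of_in_latM_iff: "dual_of d \<in> latM B \<longleftrightarrow> d \<in> latN B"
proof
  assume "dual_of d \<in> latM B"
  then have "D d (snd B) \<in> \<int>" "D d (fst B) \<in> \<int>"
    using latN_basis by (auto simp: latM_def dual_of_apply)
  then show "d \<in> latN B"
    by (simp add: latN_iff D_swap[of "fst B" d])
qed (simp add: latM_def dual_of_apply D_Ints)

lemma dual_of_scale: "dual_of (r *\<^sub>R d) = r *\<^sub>R dual_of d"
  by (intro blinfun_eqI) (simp add: dual_of_apply D_simps blinfun.scaleR_left)

lemma dual_of_inject: "dual_of d = dual_of d' \<longleftrightarrow> d = d'"
proof
  assume "dual_of d = dual_of d'"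
  then have "D d u = D d' u" for u
    by (metis dual_of_apply)
  then have "D (d - d') u = 0" for u
    by (simp add: D_simps)
  then show "d = d'"
    using D_nondegenerate[of "d - d'" "fst B" "snd B"] D_basis by simp
qed simp

lemma dual_of_zero: "dual_of 0 = 0"
  using dual_of_scale[of 0 0] by simp

lemma primitive_dual_of_iff: "primitive_in (latM B) (dual_of d) \<longleftrightarrow> primitive_in (latN B) d"
proof -
  have "(\<forall>w\<in>latM B. dual_of d = of_int k *\<^sub>R w \<longrightarrow> \<bar>k\<bar> = 1) \<longleftrightarrow>
      (\<forall>w\<in>latN B. d = of_int k *\<^sub>R w \<longrightarrow> \<bar>k\<bar> = 1)" for k :: int
  proof -
    have "(\<forall>w\<in>latM B. dual_of d = of_int k *\<^sub>R w \<longrightarrow> \<bar>k\<bar> = 1) \<longleftrightarrow>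
      (\<forall>w. dual_of w \<in> latM B \<longrightarrow> dual_of d = of_int k *\<^sub>R dual_of w \<longrightarrow> \<bar>k\<bar> = 1)"
      by (metis dual_of_surj)
    also have "\<dots> \<longleftrightarrow> (\<forall>w\<in>latN B. d = of_int k *\<^sub>R w \<longrightarrow> \<bar>k\<bar> = 1)"
      by (auto simp: dual_of_in_latM_iff dual_of_inject simp flip: dual_of_scale)
    finally show ?thesis .
  qed
  then show ?thesis
    unfolding primitive_in_def using dual_of_inject[of d 0] dual_of_zero dual_of_in_latM_iff by auto
qed

text \<open>In dual coordinates \<open>dual_of\<close> is the quarter turn taking
  \<open>(p, q)\<close> to \<open>(- q, p)\<close>. It has determinant 1, so even the sign of the
  arrow number survives.\<close>

lemma detM_dual_of:
  assumes "d \<in> latN B" "d' \<in> latN B"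
  shows "of_int (detM B (dual_of d) (dual_of d')) = D d d'"
proof -
  have "blinfun_apply (dual_of d) (fst B) * blinfun_apply (dual_of d') (snd B) -
      blinfun_apply (dual_of d) (snd B) * blinfun_apply (dual_of d') (fst B) = D d d'"
    by (subst (3) D_expand[OF D_basis, of d'])
      (simp add: dual_of_apply D_simps D_swap[of "fst B" d'] algebra_simps)
  then show ?thesis
    using D_Ints[OF assms] by (auto simp: detM_def elim: Ints_cases)
qed

end

section \<open>Cones over the edges of a triangle\<close>

lemma convex_cone_hull_2:
  fixes u v :: "'a::real_vector"
  shows "convex_cone hull {u, v} = {a *\<^sub>R u + b *\<^sub>R v | a b. 0 \<le> a \<and> 0 \<le> b}" (is "_ = ?C")
proof
  have C: "a *\<^sub>R u + b *\<^sub>R v \<in> ?C" if "0 \<le> a" "0 \<le> b" for a b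
    using that by blast
  have "convex_cone ?C"
    unfolding convex_cone_iff
  proof (intro conjI ballI allI impI)
    show "0 \<in> ?C"
      using C[of 0 0] by simp
  next
    fix x y assume "x \<in> ?C" "y \<in> ?C"
    then obtain a b a' b' where x: "0 \<le> a" "0 \<le> b" "x = a *\<^sub>R u + b *\<^sub>R v"
      and y: "0 \<le> a'" "0 \<le> b'" "y = a' *\<^sub>R u + b' *\<^sub>R v"
      by blast
    have "x + y = (a + a') *\<^sub>R u + (b + b') *\<^sub>R v"
      by (simp add: x y algebra_simps)
    then show "x + y \<in> ?C"
      using C[of "a + a'" "b + b'"] x y by (simp only: add_nonneg_nonneg)
  next
    fix x and c :: real assume "x \<in> ?C" "0 \<le> c"
    then obtain a b where x: "0 \<le> a" "0 \<le> b" "x = a *\<^sub>R u + b *\<^sub>R v"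
      by blast
    have "c *\<^sub>R x = (c * a) *\<^sub>R u + (c * b) *\<^sub>R v"
      by (simp add: x scaleR_add_right)
    then show "c *\<^sub>R x \<in> ?C"
      using C[of "c * a" "c * b"] x \<open>0 \<le> c\<close> by (simp only: mult_nonneg_nonneg)
  qed
  moreover have "u \<in> ?C" "v \<in> ?C"
    using C[of 1 0] C[of 0 1] by simp_all
  ultimately show "convex_cone hull {u, v} \<subseteq> ?C"
    by (intro hull_minimal) auto
  have "u \<in> convex_cone hull {u, v}" "v \<in> convex_cone hull {u, v}"
    by (simp_all add: hull_inc)
  then show "?C \<subseteq> convex_cone hull {u, v}"
    by (blast intro: convex_cone_hull_add convex_cone_hull_mul)
qed

lemma convex_cone_hull_convex_hull: "convex_cone hull (convex hull S) = convex_cone hull S"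
  by (simp add: antisym convex_cone_convex_cone_hull convex_hull_subset_convex_cone_hull hull_minimal
      hull_mono hull_subset)

context plane_lattice
begin

text \<open>Pairing with the partners of \<open>u\<close> and \<open>u'\<close> shows that
  \<open>a\<close> is an integer dividing 1.\<close>

lemma primitive_pos_multiple:
  assumes "primitive_in (latN B) u" "primitive_in (latN B) u'" "u' = a *\<^sub>R u" "0 \<le> a"
  shows "u' = u"
proof -
  obtain w w' where w: "u \<in> latN B" "w \<in> latN B" "D u w = 1"
    and w': "u' \<in> latN B" "w' \<in> latN B" "D u' w' = 1"
    using assms(1,2) by (auto simp: primitive_latN_iff)
  obtain i j where i: "D u' w = of_int i" and j: "D u w' = of_int j"
    using D_Ints[OF w'(1) w(2)] D_Ints[OF w(1) w'(2)] by (auto elim!: Ints_cases)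
  have a: "a = of_int i"
    using i w(3) assms(3) by (simp add: D_simps)
  have "of_int (i * j) = (1 :: real)"
    using w'(3) assms(3) j a by (simp add: D_simps)
  then have "i * j = 1"
    by linarith
  with a assms(4) have "i = 1"
    by (auto simp: zmult_eq_1_iff)
  then show ?thesis
    using a assms(3) by simp
qed

text \<open>Each pair is a nonnegative combination of the other, so the two coefficient matrices are
  nonnegative and mutually inverse. Such matrices are monomial: the pairs agree up to order and
  scaling, and primitivity removes the scaling.\<close>

lemma cone_generators_unique:
  assumes nz: "D u v \<noteq> 0"
    and prim: "primitive_in (latN B) u" "primitive_in (latN B) v"
      "primitive_in (latN B) u'" "primitive_in (latN B) v'"
    and eq: "convex_cone hull {u, v} = convex_cone hull {u', v'}"
  shows "u' = u \<and> v' = v \<or> u' = v \<and> v' = u"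
proof -
  have "u' \<in> convex_cone hull {u, v}" "v' \<in> convex_cone hull {u, v}"
    "u \<in> convex_cone hull {u', v'}" "v \<in> convex_cone hull {u', v'}"
    using eq by (metis hull_inc insertI1 insert_commute)+
  then obtain a b c d \<alpha> \<beta> \<gamma> \<delta>
    where u': "u' = a *\<^sub>R u + b *\<^sub>R v" "0 \<le> a" "0 \<le> b"
      and v': "v' = c *\<^sub>R u + d *\<^sub>R v" "0 \<le> c" "0 \<le> d"
      and u: "u = \<alpha> *\<^sub>R u' + \<beta> *\<^sub>R v'" "0 \<le> \<alpha>" "0 \<le> \<beta>"
      and v: "v = \<gamma> *\<^sub>R u' + \<delta> *\<^sub>R v'" "0 \<le> \<gamma>" "0 \<le> \<delta>"
    unfolding convex_cone_hull_2 by blast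
  have vu: "D v u = - D u v"
    by (rule D_swap)
  \<comment> \<open>Pairing with \<open>u\<close> and \<open>v\<close> compares coefficients in the
    basis \<open>u\<close>, \<open>v\<close>; this yields the entries of the matrix product.\<close>
  have "D u u = (\<alpha> * b + \<beta> * d) * D v u" "D u v = (\<alpha> * a + \<beta> * c) * D u v"
    by (subst (1) u(1), simp add: u' v' D_simps algebra_simps)+
  then have 1: "\<alpha> * b + \<beta> * d = 0" "\<alpha> * a + \<beta> * c = 1"
    using nz vu by (auto simp: D_self)
  have "D v v = (\<gamma> * a + \<delta> * c) * D u v" "D v u = (\<gamma> * b + \<delta> * d) * D v u"
    by (subst (1) v(1), simp add: u' v' D_simps algebra_simps)+
  then have 2: "\<gamma> * a + \<delta> * c = 0" "\<gamma> * b + \<delta> * d = 1"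
    using nz vu by (auto simp: D_self)
  have 3: "\<alpha> * b = 0" "\<beta> * d = 0" "\<gamma> * a = 0" "\<delta> * c = 0"
    using 1(1) 2(1) u'(2,3) v'(2,3) u(2,3) v(2,3) by (simp_all add: add_nonneg_eq_0_iff)
  show ?thesis
  proof (cases "\<alpha> = 0")
    case False
    then have b: "b = 0"
      using 3 by simp
    then have "\<delta> \<noteq> 0"
      using 2 by auto
    then have "c = 0"
      using 3 by simp
    with b show ?thesis
      using primitive_pos_multiple[of u u' a] primitive_pos_multiple[of v v' d] u' v' prim by simp
  next
    case True
    then have "\<beta> \<noteq> 0"
      using 1 by auto
    then have d: "d = 0"
      using 3 by simp
    then have "\<gamma> \<noteq> 0"
      using 2 by auto
    then have "a = 0"
      using 3 by simp
    with d show ?thesis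
      using primitive_pos_multiple[of v u' b] primitive_pos_multiple[of u v' c] u' v' prim by simp
  qed
qed

lemma prim_gens_convex_cone_hull:
  assumes "D u v \<noteq> 0" "primitive_in (latN B) u" "primitive_in (latN B) v"
  shows "prim_gens B (convex_cone hull {u, v}) \<in> {(u, v), (v, u)}"
proof -
  let ?P = "\<lambda>(u', v'). u' \<noteq> v' \<and> primitive_in (latN B) u' \<and> primitive_in (latN B) v' \<and>
      convex_cone hull {u, v} = convex_cone hull {u', v'}"
  have "?P (u, v)"
    using assms by (auto simp: D_self)
  then have "?P (prim_gens B (convex_cone hull {u, v}))"
    unfolding prim_gens_def by (rule someI)
  then show ?thesis
    using cone_generators_unique[OF assms] by (auto split: prod.splits)
qed

section \<open>Invariants of the cone over a single edge\<close>

context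
  fixes u v d w
  assumes pos: "D u v > 0"
    and prim: "primitive_in (latN B) u" "primitive_in (latN B) v" "primitive_in (latN B) d"
    and edge: "v - u = of_int w *\<^sub>R d" and w_pos: "w > 0"
begin

lemma D_edge_eq: "D d v = D d u"
  using arg_cong[OF edge, of "D d"] by (simp add: D_simps)

lemma D_edge_pos: "D u d > 0"
proof -
  have "of_int w * D u d = D u v"
    using arg_cong[OF edge, of "D u"] by (simp add: D_simps)
  then show ?thesis
    using pos w_pos by (metis of_int_0_less_iff zero_less_mult_pos)
qed

text \<open>\<open>D d\<close> is constant along the edge and negative there by the orientation. Any
  competitor \<open>D d'\<close> also kills the edge direction, so \<open>d'\<close> is
  \<open>d\<close> or \<open>- d\<close>, and the sign condition decides.\<close>

lemma cone_m_edge: "cone_m B (convex_cone hull {u, v}) = dual_of d"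
proof -
  have *: "(THE m. primitive_in (latM B) m \<and> blinfun_apply m u = blinfun_apply m v \<and>
            blinfun_apply m u < 0) = dual_of d"
  proof (rule the_equality)
    show "primitive_in (latM B) (dual_of d) \<and> blinfun_apply (dual_of d) u = blinfun_apply (dual_of d) v \<and>
            blinfun_apply (dual_of d) u < 0"
      using prim(3) D_edge_eq D_edge_pos by (simp add: primitive_dual_of_iff dual_of_apply D_swap[of d u])
  next
    fix m assume m: "primitive_in (latM B) m \<and> blinfun_apply m u = blinfun_apply m v \<and>
            blinfun_apply m u < 0"
    obtain d' where d': "m = dual_of d'"
      using dual_of_surj by blast
    with m have prim': "primitive_in (latN B) d'" and "D d' u = D d' v" and neg: "D d' u < 0"
      by (simp_all add: primitive_dual_of_iff dual_of_apply)
    then have "of_int w * D d' d = 0"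
      using arg_cong[OF edge, of "D d'"] by (simp add: D_simps)
    then have "D d d' = 0"
      using w_pos by (simp add: D_swap[of d d'])
    then obtain k where k: "d' = of_int k *\<^sub>R d"
      using primitive_parallel[OF prim(3), of d'] prim' by (auto simp: primitive_in_def)
    then have "\<bar>k\<bar> = 1"
      using prim' prim(3) by (auto simp: primitive_in_def)
    moreover have "of_int k * D d u < 0"
      using neg k by (simp add: D_simps)
    ultimately have "k = 1"
      using D_edge_pos D_swap[of d u] by (auto simp: abs_if split: if_splits)
    then show "m = dual_of d"
      using d' k by simp
  qed
  \<comment> \<open>\<open>prim_gens\<close> may return the generators in the reverse order, so the
    description is evaluated for both.\<close>
  have **: "(THE m. primitive_in (latM B) m \<and> blinfun_apply m v = blinfun_apply m u \<and>
            blinfun_apply m v < 0) = dual_of d"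
    by (subst *[symmetric]) (rule arg_cong[where f = The], auto)
  show ?thesis
    using prim_gens_convex_cone_hull[of u v] pos prim * ** by (auto simp: cone_m_def)
qed

lemma cone_l_edge: "of_int (cone_l B (convex_cone hull {u, v})) = D u d"
proof -
  have "- blinfun_apply (dual_of d) (fst (prim_gens B (convex_cone hull {u, v}))) = D u d"
    using prim_gens_convex_cone_hull[of u v] pos prim D_edge_eq
    by (auto simp: dual_of_apply D_swap[of d])
  moreover have "D u d \<in> \<int>"
    using prim D_Ints by (simp add: primitive_in_def)
  ultimately show ?thesis
    by (auto simp: cone_l_def cone_m_edge elim: Ints_cases)
qed

text \<open>Pairing with a partner of \<open>d\<close> shows that \<open>u + r d\<close> is a
  lattice point only for integral \<open>r\<close>. The range \<open>0..w\<close> has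
  \<open>w + 1\<close> elements, which matches the subtraction of 1 in
  \<open>cone_w\<close>.\<close>

lemma lattice_points_edge:
  "convex hull {u, v} \<inter> latN B = (\<lambda>i::int. u + of_int i *\<^sub>R d) ` {0..w}"
proof (intro set_eqI iffI)
  fix x assume x: "x \<in> convex hull {u, v} \<inter> latN B"
  then obtain t where t: "0 \<le> t" "t \<le> 1" "x = (1 - t) *\<^sub>R u + t *\<^sub>R v"
    by (auto simp: in_segment simp flip: segment_convex_hull)
  have v: "v = u + of_int w *\<^sub>R d"
    using edge by (simp add: algebra_simps)
  have x_eq: "x = u + (t * of_int w) *\<^sub>R d"
    unfolding t(3) v by (simp add: algebra_simps)
  obtain e where "e \<in> latN B" "D d e = 1"
    using prim(3) by (auto simp: primitive_latN_iff)
  moreover have "x - u \<in> latN B"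
    using x prim(1) by (auto simp: primitive_in_def intro: latN_diff)
  ultimately have "t * of_int w \<in> \<int>"
    using D_Ints[of "x - u" e] by (simp add: x_eq D_simps)
  then obtain i where i: "t * of_int w = of_int i"
    by (auto elim: Ints_cases)
  have "0 \<le> t * of_int w" "t * of_int w \<le> 1 * of_int w"
    using t w_pos by (auto intro: mult_right_mono)
  then have "i \<in> {0..w}"
    by (simp add: i)
  then show "x \<in> (\<lambda>i::int. u + of_int i *\<^sub>R d) ` {0..w}"
    using x_eq i by auto
next
  fix x assume "x \<in> (\<lambda>i::int. u + of_int i *\<^sub>R d) ` {0..w}"
  then obtain i :: int where i: "0 \<le> i" "i \<le> w" "x = u + of_int i *\<^sub>R d"
    by auto
  have v: "v = u + of_int w *\<^sub>R d"
    using edge by (simp add: algebra_simps)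
  have "x = (1 - of_int i / of_int w) *\<^sub>R u + (of_int i / of_int w) *\<^sub>R v"
    using w_pos unfolding v i(3) by (simp add: algebra_simps)
  moreover have "0 \<le> of_int i / (of_int w :: real)" "of_int i / (of_int w :: real) \<le> 1"
    using i w_pos by auto
  ultimately have "x \<in> convex hull {u, v}"
    unfolding segment_convex_hull[symmetric] in_segment by blast
  then show "x \<in> convex hull {u, v} \<inter> latN B"
    using i prim by (auto simp: primitive_in_def intro!: latN_closed)
qed

lemma cone_w_edge: "cone_w B (convex_cone hull {u, v}) = w"
proof -
  have "inj_on (\<lambda>i::int. u + of_int i *\<^sub>R d) {0..w}"
    using prim(3) by (auto simp: inj_on_def primitive_in_def)
  then have "int (card (convex hull {u, v} \<inter> latN B)) - 1 = w"
    using w_pos by (simp add: lattice_points_edge card_image)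
  then show ?thesis
    using prim_gens_convex_cone_hull[of u v] pos prim
    by (auto simp: cone_w_def insert_commute)
qed

end

text \<open>The sum equals \<open>D (b - a) (c - a)\<close>, twice the signed area of the
  triangle.\<close>

lemma not_affine_dependent_triangle:
  assumes "D a b + D b c + D c a \<noteq> 0"
  shows "\<not> affine_dependent {a, b, c}" "\<not> collinear {a, b, c}"
proof -
  show *: "\<not> collinear {a, b, c}"
  proof
    assume "collinear {a, b, c}"
    then consider "a = c" | t where "b = t *\<^sub>R a + (1 - t) *\<^sub>R c"
      by (auto simp: collinear_3_expand)
    then show False
      using assms by cases (simp_all add: D_simps D_swap[of c a] D_swap[of b c] algebra_simps)
  qed
  then show "\<not> affine_dependent {a, b, c}"
    by (simp add: collinear_3_eq_affine_dependent)
qed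

text \<open>An interior origin has strictly positive barycentric coordinates. Pairing this relation
  with two vertices shows that the three determinants have a common sign, so at most one
  transposition of vertices is needed.\<close>

lemma fano_triangle_cases:
  assumes "fano_triangle B P"
  obtains v1 v2 v3 where
    "primitive_in (latN B) v1" "primitive_in (latN B) v2" "primitive_in (latN B) v3"
    "D v1 v2 > 0" "D v2 v3 > 0" "D v3 v1 > 0" "P = convex hull {v1, v2, v3}"
proof -
  define E where "E = {v. v extreme_point_of P}"
  obtain S where S: "finite S" "P = convex hull S" and dim: "aff_dim P = 2" and int: "0 \<in> interior P"
    and prim: "\<And>v. v \<in> E \<Longrightarrow> primitive_in (latN B) v" and card: "card E = 3"
    using assms by (auto simp: fano_triangle_def fano_polygon_def E_def)
  have P: "P = convex hull E"
    unfolding E_def using S by (intro Krein_Milman_Minkowski) (auto intro: finite_imp_compact_convex_hull)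
  obtain a b c where E: "E = {a, b, c}" and distinct: "a \<noteq> b" "a \<noteq> c" "b \<noteq> c"
    using card by (auto simp: card_3_iff)
  have "\<not> affine_dependent {a, b, c}"
    using dim card by (simp add: affine_independent_iff_card P E aff_dim_convex_hull)
  then have ncol: "\<not> collinear {a, b, c}"
    using distinct by (simp add: collinear_3_eq_affine_dependent)
  obtain x y z where xyz: "0 < x" "0 < y" "0 < z" and sum: "x *\<^sub>R a + y *\<^sub>R b + z *\<^sub>R c = 0"
    using int interior_convex_hull_3_minimal[OF ncol] by (auto simp: P E)
  have ab: "y * D a b = z * D c a" "z * D b c = x * D a b"
    using arg_cong[OF sum, of "D a"] arg_cong[OF sum, of "D b"]
    by (simp_all add: D_simps D_swap[of c a] D_swap[of b a])
  \<comment> \<open>Otherwise all three vertices are multiples of \<open>a\<close>, contradicting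
    affine independence.\<close>
  have nz: "D a b \<noteq> 0"
  proof
    assume 0: "D a b = 0"
    then have "D a c = 0"
      using ab xyz by (simp add: D_swap[of c a])
    with 0 obtain k l where "b = of_int k *\<^sub>R a" "c = of_int l *\<^sub>R a"
      using primitive_parallel[of a] prim by (metis E insertCI primitive_in_def)
    then have "x - y \<in> range (\<lambda>r. r *\<^sub>R a)" if "x \<in> {a, b, c}" "y \<in> {a, b, c}" for x y
    proof -
      have "x \<in> range (\<lambda>r. r *\<^sub>R a)" if "x \<in> {a, b, c}" for x
        using that \<open>b = _\<close> \<open>c = _\<close> rangeI[of "\<lambda>r. r *\<^sub>R a" 1] by auto
      from this[OF that(1)] this[OF that(2)] show ?thesis
        by (auto simp flip: scaleR_diff_left)
    qed
    then have "collinear {a, b, c}"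
      unfolding collinear_def by (intro exI[of _ a]) (auto simp: image_iff)
    then show False
      using ncol by simp
  qed
  show ?thesis
  proof (cases "D a b > 0")
    case True
    then have "D c a > 0" "D b c > 0"
      using ab xyz by (metis mult_pos_pos zero_less_mult_pos)+
    then show ?thesis
      using that[of a b c] True prim P E by auto
  next
    case False
    \<comment> \<open>Exchanging \<open>a\<close> and \<open>b\<close> reverses the sign of all
      three determinants.\<close>
    then have "D b a > 0"
      using nz by (simp add: D_swap[of b a])
    moreover from this have "D a c > 0" "D c b > 0"
      using ab xyz D_swap[of a c] D_swap[of c b] D_swap[of b a]
      by (metis minus_mult_right mult_pos_pos zero_less_mult_pos)+
    ultimately show ?thesis
      using that[of b a c] prim P E by (auto simp: insert_commute)
  qed
qed

end

section \<open>Counterclockwise triangles and their fans\<close>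

locale oriented_triangle = plane_lattice +
  fixes v1 v2 v3 d1 d2 d3 :: "real ^ 2" and w1 w2 w3 :: int
  assumes prim_v: "primitive_in (latN B) v1" "primitive_in (latN B) v2" "primitive_in (latN B) v3"
    and D_pos: "D v1 v2 > 0" "D v2 v3 > 0" "D v3 v1 > 0"
    and prim_d: "primitive_in (latN B) d1" "primitive_in (latN B) d2" "primitive_in (latN B) d3"
    and w_pos: "w1 > 0" "w2 > 0" "w3 > 0"
    and edges: "v2 - v1 = of_int w1 *\<^sub>R d1" "v3 - v2 = of_int w2 *\<^sub>R d2" "v1 - v3 = of_int w3 *\<^sub>R d3"
begin

text \<open>The assumptions are cyclically symmetric, so a fact proved for one index is available
  for the other two by reinterpreting the locale.\<close>

lemma rotate: "oriented_triangle B v2 v3 v1 d2 d3 d1 w2 w3 w1"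
  using prim_v D_pos prim_d w_pos edges by unfold_locales

text \<open>Multiplied by \<open>w1 * w2\<close>, the number is twice the area of the triangle. With
  \<open>rotate\<close> this makes the block quiver cyclic.\<close>

lemma D_edges_pos: "D d1 d2 > 0"
proof -
  have "of_int (w1 * w2) * D d1 d2 = D (v2 - v1) (v3 - v2)"
    by (simp add: edges D_simps)
  also have "\<dots> = D v1 v2 + D v2 v3 + D v3 v1"
    by (simp add: D_simps D_swap[of v1 v3])
  finally have "of_int (w1 * w2) * D d1 d2 > 0"
    using D_pos by simp
  then show ?thesis
    using w_pos by (metis mult_pos_pos of_int_0_less_iff zero_less_mult_pos)
qed

lemma affine_independent: "\<not> affine_dependent {v1, v2, v3}" "\<not> collinear {v1, v2, v3}"
  using not_affine_dependent_triangle[of v1 v2 v3] D_pos by auto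

lemma distinct_vertices: "v1 \<noteq> v2" "v2 \<noteq> v3" "v3 \<noteq> v1"
  using D_pos by (auto simp: D_self)

lemma extreme_points: "{v. v extreme_point_of convex hull {v1, v2, v3}} = {v1, v2, v3}"
  using extreme_point_of_convex_hull_affine_independent[OF affine_independent(1)] by auto

lemma fano_triangle: "fano_triangle B (convex hull {v1, v2, v3})"
proof -
  have "aff_dim (convex hull {v1, v2, v3}) = 2"
    using affine_independent(1) distinct_vertices
    by (simp add: affine_independent_iff_card aff_dim_convex_hull)
  moreover have "0 \<in> interior (convex hull {v1, v2, v3})"
  proof -
    \<comment> \<open>The relation \<open>cramer\<close> among the vertices, divided by twice the
      area, writes the origin with positive weights of sum 1.\<close>
    define s where "s = D v1 v2 + D v2 v3 + D v3 v1"
    have s: "s > 0"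
      using D_pos by (simp add: s_def)
    have "(D v2 v3 / s) *\<^sub>R v1 + (D v3 v1 / s) *\<^sub>R v2 + (D v1 v2 / s) *\<^sub>R v3 =
        (1 / s) *\<^sub>R (D v2 v3 *\<^sub>R v1 + D v3 v1 *\<^sub>R v2 + D v1 v2 *\<^sub>R v3)"
      by (simp add: scaleR_add_right)
    then have "(D v2 v3 / s) *\<^sub>R v1 + (D v3 v1 / s) *\<^sub>R v2 + (D v1 v2 / s) *\<^sub>R v3 = 0"
      by (simp add: cramer)
    moreover have "D v2 v3 / s + D v3 v1 / s + D v1 v2 / s = 1"
      using s by (simp add: s_def flip: add_divide_distrib)
    ultimately show ?thesis
      using s D_pos
      by (subst interior_convex_hull_3_minimal[OF affine_independent(2)])
        (simp, intro CollectI exI[of _ "D v2 v3 / s"] exI[of _ "D v3 v1 / s"] exI[of _ "D v1 v2 / s"] conjI,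
          simp_all)
  qed
  moreover have "\<exists>S. finite S \<and> S \<subseteq> latN B \<and> convex hull {v1, v2, v3} = convex hull S"
    using prim_v by (intro exI[of _ "{v1, v2, v3}"]) (auto simp: primitive_in_def)
  moreover have "\<forall>v. v extreme_point_of convex hull {v1, v2, v3} \<longrightarrow> primitive_in (latN B) v"
    using prim_v by (auto dest!: extreme_point_of_convex_hull)
  moreover have "card {v1, v2, v3} = 3"
    using distinct_vertices by simp
  ultimately show ?thesis
    unfolding fano_triangle_def fano_polygon_def extreme_points by (intro conjI)
qed

text \<open>The line through the origin and \<open>v2\<close> separates \<open>v1\<close> strictly
  from \<open>v3\<close>, so no combination in the cone can reach \<open>v1\<close>.\<close>

lemma vertex_notin_opposite_cone: "v1 \<notin> convex_cone hull {v2, v3}"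
proof
  assume "v1 \<in> convex_cone hull {v2, v3}"
  then obtain a b where ab: "v1 = a *\<^sub>R v2 + b *\<^sub>R v3" "0 \<le> a" "0 \<le> b"
    by (auto simp: convex_cone_hull_2)
  have "D v1 v2 = - b * D v2 v3"
    by (subst ab(1)) (simp add: D_simps D_swap[of v3 v2])
  then show False
    using ab D_pos by (smt (verit) mult_nonneg_nonneg mult_minus_left)
qed

lemma vertex_in_cone_iff:
  assumes "c \<subset> {v1, v2, v3}" "v \<in> {v1, v2, v3}"
  shows "v \<in> convex_cone hull c \<longleftrightarrow> v \<in> c"
proof
  interpret r: oriented_triangle B v2 v3 v1 d2 d3 d1 w2 w3 w1 by (rule rotate)
  interpret s: oriented_triangle B v3 v1 v2 d3 d1 d2 w3 w1 w2 by (rule r.rotate)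
  assume v: "v \<in> convex_cone hull c"
  show "v \<in> c"
  proof (rule ccontr)
    assume "v \<notin> c"
    then have "c \<subseteq> {v1, v2, v3} - {v}"
      using assms by auto
    then have "v \<in> convex_cone hull ({v1, v2, v3} - {v})"
      using v hull_mono by blast
    then show False
      using assms(2) vertex_notin_opposite_cone r.vertex_notin_opposite_cone
        s.vertex_notin_opposite_cone distinct_vertices
      by (auto simp: insert_Diff_if insert_commute split: if_splits)
  qed
qed (auto intro: hull_inc)

lemma spanning_fan_triangle:
  "spanning_fan (convex hull {v1, v2, v3}) = {convex_cone hull c | c. c \<subset> {v1, v2, v3}}"
proof -
  have faces: "{F. F face_of convex hull {v1, v2, v3} \<and> F \<noteq> convex hull {v1, v2, v3}} =
      (hull) convex ` {c. c \<subset> {v1, v2, v3}}"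
  proof (intro set_eqI iffI)
    fix F assume "F \<in> {F. F face_of convex hull {v1, v2, v3} \<and> F \<noteq> convex hull {v1, v2, v3}}"
    then show "F \<in> (hull) convex ` {c. c \<subset> {v1, v2, v3}}"
      unfolding face_of_convex_hull_affine_independent[OF affine_independent(1)] by blast
  next
    fix F assume "F \<in> (hull) convex ` {c. c \<subset> {v1, v2, v3}}"
    then obtain c where c: "F = convex hull c" "c \<subset> {v1, v2, v3}"
      by blast
    \<comment> \<open>Extreme points of the hull of \<open>c\<close> lie in \<open>c\<close>, while
      those of the triangle are all three vertices.\<close>
    then have "F \<noteq> convex hull {v1, v2, v3}"
      using extreme_points extreme_points_of_convex_hull[of c] by (metis psubset_eq subset_antisym)
    then show "F \<in> {F. F face_of convex hull {v1, v2, v3} \<and> F \<noteq> convex hull {v1, v2, v3}}"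
      unfolding face_of_convex_hull_affine_independent[OF affine_independent(1)] using c by blast
  qed
  have "spanning_fan (convex hull {v1, v2, v3}) = (hull) convex_cone `
      {F. F face_of convex hull {v1, v2, v3} \<and> F \<noteq> convex hull {v1, v2, v3}}"
    unfolding spanning_fan_def by blast
  also have "\<dots> = (hull) convex_cone ` {c. c \<subset> {v1, v2, v3}}"
    by (simp only: faces image_image convex_cone_hull_convex_hull)
  also have "\<dots> = {convex_cone hull c | c. c \<subset> {v1, v2, v3}}"
    by blast
  finally show ?thesis .
qed

text \<open>The fan is thereby ordered like the proper subsets of the vertex set, whose maximal
  elements are the complements of single vertices.\<close>

lemma cone_subset_iff:
  assumes "c \<subset> {v1, v2, v3}" "c' \<subset> {v1, v2, v3}"
  shows "convex_cone hull c \<subseteq> convex_cone hull c' \<longleftrightarrow> c \<subseteq> c'"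
proof
  assume "convex_cone hull c \<subseteq> convex_cone hull c'"
  then have "v \<in> convex_cone hull c'" if "v \<in> c" for v
    using hull_inc[OF that] by (rule subsetD)
  then show "c \<subseteq> c'"
    using assms(1) vertex_in_cone_iff[OF assms(2)] by (meson psubsetE subsetD subsetI)
qed (rule hull_mono)

lemma maximal_cones_triangle:
  "maximal_cones (convex hull {v1, v2, v3}) =
    {convex_cone hull {v1, v2}, convex_cone hull {v2, v3}, convex_cone hull {v3, v1}}"
proof -
  let ?S = "{v1, v2, v3}"
  have maximal_iff: "\<sigma> \<in> maximal_cones (convex hull ?S) \<longleftrightarrow> (\<exists>c. \<sigma> = convex_cone hull c \<and> c \<subset> ?S) \<and>
      (\<forall>c'. c' \<subset> ?S \<longrightarrow> \<sigma> \<subseteq> convex_cone hull c' \<longrightarrow> \<sigma> = convex_cone hull c')" for \<sigma>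
    unfolding maximal_cones_def spanning_fan_triangle by (simp only: mem_Collect_eq Ball_def) metis
  have sub: "?S - {v} \<subset> ?S" if "v \<in> ?S" for v
    using that by (intro psubsetI Diff_subset) (metis Diff_iff singletonI)
  have "maximal_cones (convex hull ?S) = (\<lambda>v. convex_cone hull (?S - {v})) ` ?S"
  proof (intro set_eqI iffI)
    fix \<sigma> assume "\<sigma> \<in> maximal_cones (convex hull ?S)"
    then obtain c where c: "\<sigma> = convex_cone hull c" "c \<subset> ?S"
      and max: "\<And>c'. c' \<subset> ?S \<Longrightarrow> \<sigma> \<subseteq> convex_cone hull c' \<Longrightarrow> \<sigma> = convex_cone hull c'"
      unfolding maximal_iff by metis
    then obtain v where v: "v \<in> ?S" "c \<subseteq> ?S - {v}"
      by blast
    then have "\<sigma> = convex_cone hull (?S - {v})"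
      using max[OF sub] c(1) hull_mono by blast
    then show "\<sigma> \<in> (\<lambda>v. convex_cone hull (?S - {v})) ` ?S"
      using v by blast
  next
    fix \<sigma> assume "\<sigma> \<in> (\<lambda>v. convex_cone hull (?S - {v})) ` ?S"
    then obtain v where v: "v \<in> ?S" and \<sigma>: "\<sigma> = convex_cone hull (?S - {v})"
      by blast
    have "\<sigma> = convex_cone hull c" if "c \<subset> ?S" "\<sigma> \<subseteq> convex_cone hull c" for c
    proof -
      have "?S - {v} \<subseteq> c"
        using cone_subset_iff[OF sub[OF v] that(1)] that(2) \<sigma> by simp
      then have "c = ?S - {v}"
        using that(1) v by blast
      then show ?thesis
        by (simp add: \<sigma>)
    qed
    then show "\<sigma> \<in> maximal_cones (convex hull ?S)"
      unfolding maximal_iff using sub[OF v] \<sigma> by metis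
  qed
  moreover have "?S - {v1} = {v2, v3}" "?S - {v2} = {v3, v1}" "?S - {v3} = {v1, v2}"
    using distinct_vertices by auto
  ultimately show ?thesis
    by auto
qed

lemma distinct_dual_of: "dual_of d1 \<noteq> dual_of d2" "dual_of d2 \<noteq> dual_of d3" "dual_of d3 \<noteq> dual_of d1"
proof -
  interpret r: oriented_triangle B v2 v3 v1 d2 d3 d1 w2 w3 w1 by (rule rotate)
  interpret s: oriented_triangle B v3 v1 v2 d3 d1 d2 w3 w1 w2 by (rule r.rotate)
  show "dual_of d1 \<noteq> dual_of d2" "dual_of d2 \<noteq> dual_of d3" "dual_of d3 \<noteq> dual_of d1"
    using D_edges_pos r.D_edges_pos s.D_edges_pos by (auto simp: dual_of_inject D_self)
qed

text \<open>Distinct edge directions make \<open>cone_m\<close> injective on the maximal cones, so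
  \<open>the_inv_into\<close> returns the cone of each vertex and the computations for single edges
  apply.\<close>

lemma bquiv_triangle:
  defines "R \<equiv> bquiv B (convex hull {v1, v2, v3})"
  shows "quiver R = quiver_of {dual_of d1, dual_of d2, dual_of d3} (detM B)"
    and "wlabel R (dual_of d1) = w1" "wlabel R (dual_of d2) = w2" "wlabel R (dual_of d3) = w3"
    and "of_int (llabel R (dual_of d1)) = D v1 d1" "of_int (llabel R (dual_of d2)) = D v2 d2"
      "of_int (llabel R (dual_of d3)) = D v3 d3"
proof -
  note m = cone_m_edge[OF D_pos(1) prim_v(1,2) prim_d(1) edges(1) w_pos(1)]
    cone_m_edge[OF D_pos(2) prim_v(2,3) prim_d(2) edges(2) w_pos(2)]
    cone_m_edge[OF D_pos(3) prim_v(3,1) prim_d(3) edges(3) w_pos(3)]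
  let ?MC = "maximal_cones (convex hull {v1, v2, v3})"
  have inj: "inj_on (cone_m B) ?MC"
    using distinct_dual_of by (auto simp: maximal_cones_triangle inj_on_def m)
  have inv: "the_inv_into ?MC (cone_m B) (dual_of d1) = convex_cone hull {v1, v2}"
    "the_inv_into ?MC (cone_m B) (dual_of d2) = convex_cone hull {v2, v3}"
    "the_inv_into ?MC (cone_m B) (dual_of d3) = convex_cone hull {v3, v1}"
    by (rule the_inv_into_f_eq[OF inj]; simp add: m maximal_cones_triangle)+
  show "quiver R = quiver_of {dual_of d1, dual_of d2, dual_of d3} (detM B)"
    by (simp add: R_def bquiv_def Let_def maximal_cones_triangle m)
  show "wlabel R (dual_of d1) = w1" "wlabel R (dual_of d2) = w2" "wlabel R (dual_of d3) = w3"
    using cone_w_edge[OF D_pos(1) prim_v(1,2) prim_d(1) edges(1) w_pos(1)]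
      cone_w_edge[OF D_pos(2) prim_v(2,3) prim_d(2) edges(2) w_pos(2)]
      cone_w_edge[OF D_pos(3) prim_v(3,1) prim_d(3) edges(3) w_pos(3)]
    by (simp_all add: R_def bquiv_def Let_def inv)
  show "of_int (llabel R (dual_of d1)) = D v1 d1" "of_int (llabel R (dual_of d2)) = D v2 d2"
      "of_int (llabel R (dual_of d3)) = D v3 d3"
    using cone_l_edge[OF D_pos(1) prim_v(1,2) prim_d(1) edges(1) w_pos(1)]
      cone_l_edge[OF D_pos(2) prim_v(2,3) prim_d(2) edges(2) w_pos(2)]
      cone_l_edge[OF D_pos(3) prim_v(3,1) prim_d(3) edges(3) w_pos(3)]
    by (simp_all add: R_def bquiv_def Let_def inv)
qed

end

lemma (in plane_lattice) fano_triangle_data: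
  assumes "fano_triangle B P"
  obtains v1 v2 v3 d1 d2 d3 w1 w2 w3 where "oriented_triangle B v1 v2 v3 d1 d2 d3 w1 w2 w3"
    "P = convex hull {v1, v2, v3}"
proof -
  obtain v1 v2 v3 where
    v: "primitive_in (latN B) v1" "primitive_in (latN B) v2" "primitive_in (latN B) v3"
    "D v1 v2 > 0" "D v2 v3 > 0" "D v3 v1 > 0" and P: "P = convex hull {v1, v2, v3}"
    using fano_triangle_cases[OF assms] by blast
  have edge: "\<exists>k d. k > 0 \<and> primitive_in (latN B) d \<and> v - u = of_int k *\<^sub>R d"
    if uv: "primitive_in (latN B) u" "primitive_in (latN B) v" "D u v > 0" for u v
  proof -
    have "v - u \<in> latN B" "v - u \<noteq> 0"
      using uv by (auto simp: primitive_in_def D_self intro: latN_diff)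
    from primitive_part[OF this] show ?thesis
      by (metis primitive_latN_iff)
  qed
  obtain w1 d1 w2 d2 w3 d3 where "w1 > 0" "primitive_in (latN B) d1" "v2 - v1 = of_int w1 *\<^sub>R d1"
    "w2 > 0" "primitive_in (latN B) d2" "v3 - v2 = of_int w2 *\<^sub>R d2"
    "w3 > 0" "primitive_in (latN B) d3" "v1 - v3 = of_int w3 *\<^sub>R d3"
    using edge[of v1 v2] edge[of v2 v3] edge[of v3 v1] v by blast
  then have "oriented_triangle B v1 v2 v3 d1 d2 d3 w1 w2 w3"
    using v by unfold_locales
  then show ?thesis
    using that P by blast
qed

section \<open>The numerical conditions\<close>

lemma rat_coprime_of_int: "rat_coprime (of_int a) (of_int b) \<longleftrightarrow> coprime a b"
  by (auto simp: rat_coprime_def coprime_iff_gcd_eq_1)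

text \<open>Clearing the denominators \<open>- l1\<close>, \<open>w2\<close>, \<open>w3\<close>
  leaves integer equations, the form that both directions use. The signs of \<open>s2\<close> and
  \<open>s3\<close> disappear because coprimality ignores them.\<close>

lemma numerical_conditions_iff:
  fixes w1 w2 w3 l1 l2 l3 a12 a13 :: int
  assumes pos: "w2 > 0" "w3 > 0" "l1 > 0"
  shows "numerical_conditions w1 w2 w3 l1 l2 l3 a12 a13 \<longleftrightarrow>
    (\<exists>x1 x2 x3 y3 t2 t3. x2 = x1 + w1 \<and> y3 = w2 * a12 - l1 \<and> y3 > 0 \<and>
      coprime x1 l1 \<and> coprime x2 l1 \<and> coprime x3 y3 \<and> coprime a12 t2 \<and> coprime a13 t3 \<and>
      w3 * l3 = - (l1 * x3) - x1 * y3 \<and> w2 * l2 = x2 * y3 + l1 * x3 \<and>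
      x3 - x2 = w2 * t2 \<and> x1 - x3 = w3 * t3)"
    (is "?L \<longleftrightarrow> ?R")
proof
  assume ?L
  define y3 where "y3 = - l1 + w2 * a12"
  define X3 :: "int \<Rightarrow> rat" where "X3 x = (of_int (w3 * l3) + of_int x * of_int y3) / of_int (- l1)" for x
  obtain x where x: "y3 > 0" "gcd x (- l1) = 1" "gcd (x + w1) (- l1) = 1"
      "(X3 x - of_int (x + w1)) / of_int w2 \<in> \<int>" "(of_int x - X3 x) / of_int w3 \<in> \<int>"
      "X3 x = (of_int (x + w1) * of_int y3 - of_int (w2 * l2)) / of_int (- l1)"
      "rat_coprime (X3 x) (of_int y3)"
      "rat_coprime (of_int (- a12)) ((X3 x - of_int (x + w1)) / of_int w2)"
      "rat_coprime (of_int (- a13)) ((of_int x - X3 x) / of_int w3)"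
    using \<open>?L\<close>
    unfolding numerical_conditions_def Let_def y3_def[symmetric] X3_def[symmetric]
    by (elim conjE exE) (rule that)
  obtain t2 t3 where t: "(X3 x - of_int (x + w1)) / of_int w2 = of_int t2"
      "(of_int x - X3 x) / of_int w3 = of_int t3"
    using x(4,5) by (auto elim!: Ints_cases)
  \<comment> \<open>Integrality of the rational \<open>x3\<close> is part of
    \<open>rat_coprime\<close>.\<close>
  obtain x3 where x3: "X3 x = of_int x3"
    using x(7) by (auto simp: rat_coprime_def)
  have nz: "(of_int (- l1) :: rat) \<noteq> 0"
    using pos by simp
  have "(of_int (x3 - (x + w1)) :: rat) = of_int (w2 * t2)"
    using t(1) pos by (simp add: x3 divide_eq_eq mult.commute)
  then have 1: "x3 - (x + w1) = w2 * t2"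
    by (simp only: of_int_eq_iff)
  have "(of_int (x - x3) :: rat) = of_int (w3 * t3)"
    using t(2) pos by (simp add: x3 divide_eq_eq mult.commute)
  then have 2: "x - x3 = w3 * t3"
    by (simp only: of_int_eq_iff)
  have "(of_int (w3 * l3 + x * y3) :: rat) = of_int (x3 * - l1)"
    using x3 unfolding X3_def nonzero_divide_eq_eq[OF nz] by (simp only: of_int_add of_int_mult)
  then have 3: "w3 * l3 + x * y3 = x3 * - l1"
    by (simp only: of_int_eq_iff)
  have "(of_int ((x + w1) * y3 - w2 * l2) :: rat) = of_int (x3 * - l1)"
    using x(6) unfolding x3 nonzero_eq_divide_eq[OF nz] by (simp only: of_int_diff of_int_mult)
  then have 4: "(x + w1) * y3 - w2 * l2 = x3 * - l1"
    by (simp only: of_int_eq_iff)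
  have "coprime x l1" "coprime (x + w1) l1"
    using x(2,3) by (simp_all add: coprime_iff_gcd_eq_1)
  moreover have "coprime x3 y3" "coprime (- a12) t2" "coprime (- a13) t3"
    using x(7-9) by (simp_all only: x3 t[unfolded x3] rat_coprime_of_int)
  moreover have "w3 * l3 = - (l1 * x3) - x * y3" "w2 * l2 = (x + w1) * y3 + l1 * x3"
    using 3 4 by (simp_all add: algebra_simps)
  moreover have "y3 = w2 * a12 - l1"
    by (simp add: y3_def)
  ultimately show ?R
    using 1 2 x(1) by (simp only: coprime_minus_left_iff) blast
next
  assume ?R
  then obtain x1 x2 x3 y3 t2 t3 where x2: "x2 = x1 + w1" and y3: "y3 = w2 * a12 - l1" "y3 > 0"
    and cop: "coprime x1 l1" "coprime x2 l1" "coprime x3 y3" "coprime a12 t2" "coprime a13 t3"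
    and eqs: "w3 * l3 = - (l1 * x3) - x1 * y3" "w2 * l2 = x2 * y3 + l1 * x3"
      "x3 - x2 = w2 * t2" "x1 - x3 = w3 * t3"
    by blast
  have nz: "(of_int (- l1) :: rat) \<noteq> 0" "(of_int w2 :: rat) \<noteq> 0" "(of_int w3 :: rat) \<noteq> 0"
    using pos by auto
  have "of_int (w3 * l3) + of_int x1 * of_int y3 = (of_int (w3 * l3 + x1 * y3) :: rat)"
    by simp
  also have "w3 * l3 + x1 * y3 = x3 * - l1"
    by (simp add: eqs(1))
  finally have X3: "(of_int (w3 * l3) + of_int x1 * of_int y3) / of_int (- l1) = (of_int x3 :: rat)"
    unfolding nonzero_divide_eq_eq[OF nz(1)] by (simp only: of_int_mult)
  have "of_int x2 * of_int y3 - of_int (w2 * l2) = (of_int (x2 * y3 - w2 * l2) :: rat)"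
    by simp
  also have "x2 * y3 - w2 * l2 = x3 * - l1"
    by (simp add: eqs(2))
  finally have X3': "(of_int x2 * of_int y3 - of_int (w2 * l2)) / of_int (- l1) = (of_int x3 :: rat)"
    unfolding nonzero_divide_eq_eq[OF nz(1)] by (simp only: of_int_mult)
  have T2: "(of_int x3 - of_int x2) / of_int w2 = (of_int t2 :: rat)"
    unfolding nonzero_divide_eq_eq[OF nz(2)] of_int_diff[symmetric] eqs(3) by simp
  have T3: "(of_int x1 - of_int x3) / of_int w3 = (of_int t3 :: rat)"
    unfolding nonzero_divide_eq_eq[OF nz(3)] of_int_diff[symmetric] eqs(4) by simp
  have y3': "- l1 + w2 * a12 = y3"
    by (simp add: y3)
  show ?L
    unfolding numerical_conditions_def Let_def y3' x2[symmetric]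
    using y3(2) cop
    by (intro conjI exI[of _ x1])
      (simp_all only: x2[symmetric] X3 X3' T2 T3 rat_coprime_of_int Ints_of_int coprime_minus_left_iff,
       simp_all flip: coprime_iff_gcd_eq_1)
qed

context plane_lattice
begin

lemma D_coords:
  assumes "D d e = 1"
  shows "D u v = D u e * D d v - D d u * D v e"
  by (subst D_expand[OF assms, of v]) (simp add: D_simps D_swap[of u d])

text \<open>Written in coordinates, \<open>D u v = 1\<close> for a partner \<open>v\<close> is a
  Bezout identity for \<open>x\<close> and \<open>y\<close>.\<close>

lemma primitive_coprime_coords:
  assumes prim: "primitive_in (latN B) u" and "d \<in> latN B" "e \<in> latN B" and de: "D d e = 1"
    and "D u e = of_int x" "D d u = of_int y"
  shows "coprime x y"
proof -
  obtain v where v: "v \<in> latN B" "D u v = 1"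
    using prim by (auto simp: primitive_latN_iff)
  obtain i j where "D d v = of_int i" "D v e = of_int j"
    using D_Ints[OF assms(2) v(1)] D_Ints[OF v(1) assms(3)] by (auto elim!: Ints_cases)
  then have "of_int (x * i - y * j) = (1 :: real)"
    using D_coords[OF de, of u v] assms v by simp
  then have "x * i - y * j = 1"
    by linarith
  then show ?thesis
    by (metis coprimeI dvd_diff dvd_mult2)
qed

text \<open>Lattice points by coordinates in \<open>B\<close>. In the construction from numbers,
  \<open>fst B\<close> and \<open>snd B\<close> serve as d1 and e, so any given lattice carries the
  triangle.\<close>

definition pt :: "int \<Rightarrow> int \<Rightarrow> real ^ 2" where
  "pt x y = of_int x *\<^sub>R fst B + of_int y *\<^sub>R snd B"

lemma pt_latN: "pt x y \<in> latN B"
  by (auto simp: pt_def latN_def)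

lemma D_pt: "D (pt x y) (pt x' y') = of_int (x * y' - y * x')"
  by (simp add: pt_def D_simps D_basis D_swap[of "snd B"] algebra_simps)

lemma pt_diff: "pt x y - pt x' y' = pt (x - x') (y - y')"
  by (simp add: pt_def algebra_simps)

lemma pt_scale: "of_int k *\<^sub>R pt x y = pt (k * x) (k * y)"
  by (simp add: pt_def algebra_simps)

lemma primitive_pt:
  assumes "coprime x y"
  shows "primitive_in (latN B) (pt x y)"
proof -
  obtain s t where "s * x + t * y = 1"
    using bezout_int[of x y] assms by auto
  then have "D (pt x y) (pt (- t) s) = 1"
    by (simp add: D_pt algebra_simps flip: of_int_mult of_int_add)
  then show ?thesis
    using pt_latN by (auto simp: primitive_latN_iff)
qed

lemma oriented_triangle_of_conditions:
  assumes pos: "w1 > 0" "w2 > 0" "w3 > 0" "l1 > 0" "l2 > 0" "l3 > 0"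
    and balanced: "w2 * a12 + w3 * a13 = 0" "w3 * a23 = w1 * a12"
    and "numerical_conditions w1 w2 w3 l1 l2 l3 a12 a13"
  obtains v1 v2 v3 d1 d2 d3 where "oriented_triangle B v1 v2 v3 d1 d2 d3 w1 w2 w3"
    "D v1 d1 = of_int l1" "D v2 d2 = of_int l2" "D v3 d3 = of_int l3"
    "D d1 d2 = of_int a12" "D d1 d3 = of_int a13" "D d2 d3 = of_int a23"
proof -
  obtain x1 x2 x3 y3 t2 t3 where x2: "x2 = x1 + w1" and y3: "y3 = w2 * a12 - l1"
    and cop: "coprime x1 l1" "coprime x2 l1" "coprime x3 y3" "coprime a12 t2" "coprime a13 t3"
    and eqs: "w3 * l3 = - (l1 * x3) - x1 * y3" "w2 * l2 = x2 * y3 + l1 * x3"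
      "x3 - x2 = w2 * t2" "x1 - x3 = w3 * t3"
    using assms numerical_conditions_iff[of w2 w3 l1 w1 l2 l3 a12 a13] by blast
  \<comment> \<open>The height difference along the closing edge, which must be \<open>w3\<close>
    times the second coordinate \<open>a13\<close> of its direction.\<close>
  have y1: "- l1 - y3 = w3 * a13"
    using balanced(1) y3 by simp
  have tri: "oriented_triangle B (pt x1 (- l1)) (pt x2 (- l1)) (pt x3 y3)
      (pt 1 0) (pt t2 a12) (pt t3 a13) w1 w2 w3"
  proof
    show "primitive_in (latN B) (pt x1 (- l1))" "primitive_in (latN B) (pt x2 (- l1))"
      "primitive_in (latN B) (pt x3 y3)" "primitive_in (latN B) (pt 1 0)"
      "primitive_in (latN B) (pt t2 a12)" "primitive_in (latN B) (pt t3 a13)"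
      using cop by (auto intro!: primitive_pt simp: coprime_commute)
    \<comment> \<open>The determinants of consecutive vertices are the products
      \<open>w1 * l1\<close>, \<open>w2 * l2\<close>, \<open>w3 * l3\<close>, so positive labels
      give the orientation.\<close>
    have "x1 * - l1 - - l1 * x2 = w1 * l1" "x2 * y3 - - l1 * x3 = w2 * l2" "x3 * - l1 - y3 * x1 = w3 * l3"
      unfolding eqs x2 by (simp_all add: algebra_simps)
    then show "D (pt x1 (- l1)) (pt x2 (- l1)) > 0" "D (pt x2 (- l1)) (pt x3 y3) > 0"
      "D (pt x3 y3) (pt x1 (- l1)) > 0"
      unfolding D_pt using pos by (simp_all only: of_int_0_less_iff mult_pos_pos)
    show "pt x2 (- l1) - pt x1 (- l1) = of_int w1 *\<^sub>R pt 1 0"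
      "pt x3 y3 - pt x2 (- l1) = of_int w2 *\<^sub>R pt t2 a12"
      "pt x1 (- l1) - pt x3 y3 = of_int w3 *\<^sub>R pt t3 a13"
      unfolding pt_diff pt_scale eqs y1 by (simp_all add: x2 y3)
  qed (use pos in auto)
  have "w2 * (x2 * a12 - - l1 * t2) = x2 * (w2 * a12) + l1 * (w2 * t2)"
    by (simp add: algebra_simps)
  also have "\<dots> = w2 * l2"
    unfolding eqs(2) eqs(3)[symmetric] y3 by (simp add: algebra_simps)
  finally have l2: "x2 * a12 - - l1 * t2 = l2"
    using pos by simp
  have "w3 * (x3 * a13 - y3 * t3) = x3 * (w3 * a13) - y3 * (w3 * t3)"
    by (simp add: algebra_simps)
  also have "\<dots> = w3 * l3"
    unfolding eqs(1) eqs(4)[symmetric] y1[symmetric] by (simp add: algebra_simps)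
  finally have l3: "x3 * a13 - y3 * t3 = l3"
    using pos by simp
  \<comment> \<open>The determinant of the second and third edge vectors. As the edges sum to zero,
    it equals that of the first and second, \<open>w1 * w2 * a12\<close>, which balancing at the
    second vertex rewrites as \<open>w2 * w3 * a23\<close>.\<close>
  have "w2 * (w3 * (t2 * a13 - a12 * t3)) = (w2 * t2) * (w3 * a13) - (w2 * a12) * (w3 * t3)"
    by (simp add: algebra_simps)
  also have "w3 * a13 = - (w2 * a12)"
    using balanced(1) by simp
  also have "w2 * t2 * - (w2 * a12) - w2 * a12 * (w3 * t3) = w2 * a12 * (- (w2 * t2) - w3 * t3)"
    by (simp add: algebra_simps)
  also have "\<dots> = w2 * (w3 * a23)"
    unfolding eqs(3,4)[symmetric] balanced(2) x2 by (simp add: algebra_simps)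
  finally have a23: "t2 * a13 - a12 * t3 = a23"
    using pos by simp
  show ?thesis
    by (rule that[OF tri]) (simp_all add: D_pt l2[simplified] l3 a23 flip: of_int_mult of_int_diff of_int_add)
qed

end

context oriented_triangle
begin

lemma D_vertex_edge: "D v1 d1 > 0" "D v2 d2 > 0" "D v3 d3 > 0"
  using D_edge_pos[OF D_pos(1) prim_v(1,2) prim_d(1) edges(1) w_pos(1)]
    D_edge_pos[OF D_pos(2) prim_v(2,3) prim_d(2) edges(2) w_pos(2)]
    D_edge_pos[OF D_pos(3) prim_v(3,1) prim_d(3) edges(3) w_pos(3)] .

text \<open>All equations arise by applying \<open>D d1\<close> and \<open>D _ e\<close> to the
  edges, and by pairing an edge with its starting vertex; the coprimalities express primitivity of
  vertices and directions.\<close>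

lemma numerical_conditions_triangle:
  assumes l: "D v1 d1 = of_int l1" "D v2 d2 = of_int l2" "D v3 d3 = of_int l3"
    and a: "D d1 d2 = of_int a12" "D d1 d3 = of_int a13"
  shows "numerical_conditions w1 w2 w3 l1 l2 l3 a12 a13"
proof -
  have lat: "v1 \<in> latN B" "v2 \<in> latN B" "v3 \<in> latN B" "d1 \<in> latN B" "d2 \<in> latN B" "d3 \<in> latN B"
    using prim_v prim_d by (auto simp: primitive_in_def)
  obtain e where e: "e \<in> latN B" "D d1 e = 1"
    using prim_d(1) by (auto simp: primitive_latN_iff)
  obtain x1 x2 x3 y3 t2 t3 where x: "D v1 e = of_int x1" "D v2 e = of_int x2" "D v3 e = of_int x3"
    and y: "D d1 v3 = of_int y3" and t: "D d2 e = of_int t2" "D d3 e = of_int t3"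
    using D_Ints lat e(1) by (metis Ints_cases)
  have y1: "D d1 v1 = of_int (- l1)"
    using l(1) D_swap[of d1 v1] by simp
  then have y2: "D d1 v2 = of_int (- l1)"
    using D_edge_eq[OF D_pos(1) prim_v(1,2) prim_d(1) edges(1) w_pos(1)] by simp
  have "of_int (x2 - x1) = (of_int w1 :: real)"
    using arg_cong[OF edges(1), of "\<lambda>u. D u e"] x e by (simp add: D_simps)
  then have x2: "x2 = x1 + w1"
    by linarith
  have "(of_int (y3 - - l1) :: real) = of_int (w2 * a12)"
    using arg_cong[OF edges(2), of "D d1"] y y2 a by (simp add: D_simps)
  then have y3: "y3 = w2 * a12 - l1"
    unfolding of_int_eq_iff by simp
  have "(of_int (x3 - x2) :: real) = of_int (w2 * t2)"
    using arg_cong[OF edges(2), of "\<lambda>u. D u e"] x t by (simp add: D_simps)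
  then have t2: "x3 - x2 = w2 * t2"
    unfolding of_int_eq_iff .
  have "(of_int (x1 - x3) :: real) = of_int (w3 * t3)"
    using arg_cong[OF edges(3), of "\<lambda>u. D u e"] x t by (simp add: D_simps)
  then have t3: "x1 - x3 = w3 * t3"
    unfolding of_int_eq_iff .
  have "(of_int (w2 * l2) :: real) = D v2 v3"
    using arg_cong[OF edges(2), of "D v2"] l by (simp add: D_simps)
  also have "\<dots> = of_int (x2 * y3 + l1 * x3)"
    using D_coords[OF e(2), of v2 v3] x y y2 by simp
  finally have l2: "w2 * l2 = x2 * y3 + l1 * x3"
    unfolding of_int_eq_iff .
  have "(of_int (w3 * l3) :: real) = D v3 v1"
    using arg_cong[OF edges(3), of "D v3"] l by (simp add: D_simps)
  also have "\<dots> = of_int (- (l1 * x3) - x1 * y3)"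
    using D_coords[OF e(2), of v3 v1] x y y1 by simp
  finally have l3: "w3 * l3 = - (l1 * x3) - x1 * y3"
    unfolding of_int_eq_iff .
  have l1_pos: "l1 > 0"
    using D_vertex_edge(1) l(1) by simp
  \<comment> \<open>Applying \<open>D d1\<close> to \<open>cramer\<close> gives a positive
    combination of the heights \<open>- l1\<close>, \<open>- l1\<close>, \<open>y3\<close> that
    vanishes, so \<open>y3\<close> has the opposite sign.\<close>
  have "D v1 v2 * of_int y3 = (D v2 v3 + D v3 v1) * of_int l1"
    using arg_cong[OF cramer[of v2 v3 v1], of "D d1"] y y1 y2 by (simp add: D_simps algebra_simps)
  also have "\<dots> > 0"
    using D_pos l1_pos by simp
  finally have y3_pos: "y3 > 0"
    using D_pos(1) by (simp add: zero_less_mult_iff)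
  note coprime_coords = primitive_coprime_coords[OF _ lat(4) e]
  have cop: "coprime x1 l1" "coprime x2 l1" "coprime x3 y3" "coprime a12 t2" "coprime a13 t3"
    using coprime_coords[OF prim_v(1) x(1) y1] coprime_coords[OF prim_v(2) x(2) y2]
      coprime_coords[OF prim_v(3) x(3) y] coprime_coords[OF prim_d(2) t(1) a(1)]
      coprime_coords[OF prim_d(3) t(2) a(2)]
    by (simp_all add: coprime_commute)
  show ?thesis
    unfolding numerical_conditions_iff[OF w_pos(2,3) l1_pos]
    using x2 y3 y3_pos cop t2 t3 l2 l3 by blast
qed

text \<open>Rounding in \<open>detM\<close> does not commute with negation, hence the restriction to
  vectors coming from the lattice.\<close>

lemma detM_skew:
  assumes "m \<in> {dual_of d1, dual_of d2, dual_of d3}" "m' \<in> {dual_of d1, dual_of d2, dual_of d3}"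
  shows "detM B m' m = - detM B m m'"
proof -
  obtain d d' where d: "m = dual_of d" "m' = dual_of d'" "d \<in> latN B" "d' \<in> latN B"
    using assms prim_d by (auto simp: primitive_in_def)
  have "real_of_int (detM B m' m) = of_int (- detM B m m')"
    using D_swap[of d' d] by (simp add: d detM_dual_of)
  then show ?thesis
    unfolding of_int_eq_iff .
qed

end

section \<open>The equivalence for block quivers of balanced quivers\<close>

theorem proposition8p2:
  fixes Q :: "('v, 'e) decorated_quiver" and N :: oriented_lattice
  assumes "is_decorated_quiver Q"
    and "balanced Q"
    and "card (qverts (block_quiver Q)) = 3"
    and "is_oriented_lattice N"
  shows "(\<exists>m1 \<in> qverts (block_quiver Q). triangle_conditions (block_quiver Q) m1) \<longleftrightarrow>
         is_block_quiver_of_fano_triangle N (block_quiver Q)"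
proof -
  interpret plane_lattice N
    using assms(4) by unfold_locales
  define R where "R = block_quiver Q"
  define V where "V = qverts R"
  define a where "a X Y = signed_arrows Q (rep X) (rep Y)" for X Y
  have R: "quiver R = quiver_of V a"
    by (simp add: V_def R_def block_quiver_def a_def[abs_def] quiver_of_def)
  have skew: "a Y X = - a X Y" for X Y
    unfolding a_def by (rule signed_arrows_swap)
  have arrows: "signed_arrows R X Y = a X Y" if "X \<in> V" "Y \<in> V" for X Y
    using signed_arrows_quiver_of[OF R that skew] .
  have balance: "(\<Sum>Y\<in>V. wlabel R Y * a X Y) = 0" if "X \<in> V" for X
    using block_quiver_balanced[OF assms(1,2)] that by (simp add: V_def R_def a_def)
  have "is_block_quiver_of_fano_triangle N R"
    if m: "distinct [m1, m2, m3]" "V = {m1, m2, m3}"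
      and labels: "\<forall>m \<in> {m1, m2, m3}. wlabel R m \<ge> 1 \<and> llabel R m \<ge> 1"
      and num: "numerical_conditions (wlabel R m1) (wlabel R m2) (wlabel R m3)
          (llabel R m1) (llabel R m2) (llabel R m3) (a m1 m2) (a m1 m3)" for m1 m2 m3
  proof -
    have self: "a X X = 0" for X
      using skew[of X X] by simp
    \<comment> \<open>The balancing relations at \<open>m1\<close> and \<open>m2\<close>;
      skew-symmetry turns the second into a formula for \<open>a m2 m3\<close>.\<close>
    have balanced: "wlabel R m2 * a m1 m2 + wlabel R m3 * a m1 m3 = 0"
      "wlabel R m3 * a m2 m3 = wlabel R m1 * a m1 m2"
      using balance[of m1] balance[of m2] m self by (simp_all add: skew[of m2 m1])
    have pos: "wlabel R m1 > 0" "wlabel R m2 > 0" "wlabel R m3 > 0"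
      "llabel R m1 > 0" "llabel R m2 > 0" "llabel R m3 > 0"
      using labels by auto
    obtain v1 v2 v3 d1 d2 d3 where
      tri: "oriented_triangle N v1 v2 v3 d1 d2 d3 (wlabel R m1) (wlabel R m2) (wlabel R m3)"
      and l: "D v1 d1 = of_int (llabel R m1)" "D v2 d2 = of_int (llabel R m2)"
        "D v3 d3 = of_int (llabel R m3)"
      and D: "D d1 d2 = of_int (a m1 m2)" "D d1 d3 = of_int (a m1 m3)" "D d2 d3 = of_int (a m2 m3)"
      by (rule oriented_triangle_of_conditions[OF pos balanced num])
    interpret oriented_triangle N v1 v2 v3 d1 d2 d3 "wlabel R m1" "wlabel R m2" "wlabel R m3"
      by (rule tri)
    define R' where "R' = bquiv N (convex hull {v1, v2, v3})"
    note R' = bquiv_triangle[folded R'_def]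
    have d: "d1 \<in> latN N" "d2 \<in> latN N" "d3 \<in> latN N"
      using prim_d by (auto simp: primitive_in_def)
    define f where "f X = (if X = m1 then dual_of d1 else if X = m2 then dual_of d2 else dual_of d3)" for X
    have f: "f m1 = dual_of d1" "f m2 = dual_of d2" "f m3 = dual_of d3"
      using m by (auto simp: f_def)
    have bij: "bij_betw f V {dual_of d1, dual_of d2, dual_of d3}"
      using m distinct_dual_of by (auto simp: bij_betw_def inj_on_def f)
    have "\<forall>X\<in>{m1, m2, m3}. \<forall>Y\<in>{m1, m2, m3}. real_of_int (detM N (f X) (f Y)) = of_int (a X Y)"
      by (simp add: f d D detM_dual_of self D_self skew[of m2 m1] skew[of m3 m1] skew[of m3 m2]
          D_swap[of d2 d1] D_swap[of d3 d1] D_swap[of d3 d2] del: of_int_eq_iff)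
    then have "\<forall>X\<in>V. \<forall>Y\<in>V. detM N (f X) (f Y) = a X Y"
      unfolding of_int_eq_iff m(2) .
    moreover have "\<forall>X\<in>{m1, m2, m3}. wlabel R' (f X) = wlabel R X \<and> llabel R' (f X) = llabel R X"
      using R'(5-7) by (simp add: f R'(2-4) l)
    ultimately have "decorated_quiver_iso R R'"
      using bij decorated_quiver_iso_quiver_of[OF R skew R'(1) detM_skew]
      unfolding m(2)[symmetric] by blast
    then show ?thesis
      using fano_triangle by (auto simp: is_block_quiver_of_fano_triangle_def R'_def)
  qed
  moreover have "\<exists>m1\<in>V. triangle_conditions R m1" if fano: "is_block_quiver_of_fano_triangle N R"
  proof -
    obtain P where P: "fano_triangle N P" and iso: "decorated_quiver_iso R (bquiv N P)"
      using fano by (auto simp: is_block_quiver_of_fano_triangle_def)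
    obtain v1 v2 v3 d1 d2 d3 w1 w2 w3 where tri: "oriented_triangle N v1 v2 v3 d1 d2 d3 w1 w2 w3"
      and P_eq: "P = convex hull {v1, v2, v3}"
      using fano_triangle_data[OF P] .
    interpret oriented_triangle N v1 v2 v3 d1 d2 d3 w1 w2 w3
      by (rule tri)
    interpret r: oriented_triangle N v2 v3 v1 d2 d3 d1 w2 w3 w1
      by (rule rotate)
    interpret s: oriented_triangle N v3 v1 v2 d3 d1 d2 w3 w1 w2
      by (rule r.rotate)
    define R' where "R' = bquiv N P"
    note R' = bquiv_triangle[folded P_eq, folded R'_def]
    have d: "d1 \<in> latN N" "d2 \<in> latN N" "d3 \<in> latN N"
      using prim_d by (auto simp: primitive_in_def)
    obtain f where bij: "bij_betw f V {dual_of d1, dual_of d2, dual_of d3}"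
      and det: "\<And>X Y. X \<in> V \<Longrightarrow> Y \<in> V \<Longrightarrow> detM N (f X) (f Y) = a X Y"
      and labels: "\<And>X. X \<in> V \<Longrightarrow> wlabel R' (f X) = wlabel R X \<and> llabel R' (f X) = llabel R X"
      using iso decorated_quiver_iso_quiver_of[OF R skew R'(1) detM_skew] unfolding R'_def by blast
    \<comment> \<open>The vertices are numbered by the counterclockwise order of the edges; the
      chosen \<open>m1\<close> is the one matched with the first edge.\<close>
    obtain m1 m2 m3 where m: "m1 \<in> V" "m2 \<in> V" "m3 \<in> V" and f: "f m1 = dual_of d1" "f m2 = dual_of d2" "f m3 = dual_of d3"
      using bij by (metis bij_betw_imp_surj_on imageE insertCI)
    have V: "V = {m1, m2, m3}"
    proof -
      have inj: "inj_on f V" and im: "f ` V = f ` {m1, m2, m3}"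
        using bij f by (simp_all add: bij_betw_def)
      show ?thesis
        using inj_on_image_eq_iff[OF inj order_refl, of "{m1, m2, m3}"] im m by simp
    qed
    have w: "wlabel R m1 = w1" "wlabel R m2 = w2" "wlabel R m3 = w3"
      and l: "D v1 d1 = of_int (llabel R m1)" "D v2 d2 = of_int (llabel R m2)"
        "D v3 d3 = of_int (llabel R m3)"
      using labels[OF m(1)] labels[OF m(2)] labels[OF m(3)] R'(2-7) by (simp_all add: f)
    have D: "D d1 d2 = of_int (a m1 m2)" "D d2 d3 = of_int (a m2 m3)" "D d3 d1 = of_int (a m3 m1)"
      "D d1 d3 = of_int (a m1 m3)"
      using d m by (simp_all add: f detM_dual_of flip: det)
    have "a m1 m2 \<ge> 1" "a m2 m3 \<ge> 1" "a m3 m1 \<ge> 1"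
      using D_edges_pos r.D_edges_pos s.D_edges_pos D by simp_all
    moreover have "llabel R m1 \<ge> 1" "llabel R m2 \<ge> 1" "llabel R m3 \<ge> 1"
      using D_vertex_edge l by simp_all
    moreover have "distinct [m1, m2, m3]"
      using f distinct_dual_of by auto
    moreover have "numerical_conditions w1 w2 w3 (llabel R m1) (llabel R m2) (llabel R m3) (a m1 m2) (a m1 m3)"
      using numerical_conditions_triangle[OF l D(1,4)] .
    ultimately have "triangle_conditions R m1"
      unfolding triangle_conditions_def using w w_pos V m
      by (intro exI[of _ m2] exI[of _ m3]) (simp add: arrows V_def)
    then show ?thesis
      using m by blast
  qed
  moreover have "is_block_quiver_of_fano_triangle N R" if cond: "\<exists>m1\<in>V. triangle_conditions R m1"
  proof -
    obtain m1 m2 m3 where "distinct [m1, m2, m3]" and V: "V = {m1, m2, m3}"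
      and "\<forall>m \<in> {m1, m2, m3}. wlabel R m \<ge> 1 \<and> llabel R m \<ge> 1"
      and "numerical_conditions (wlabel R m1) (wlabel R m2) (wlabel R m3)
          (llabel R m1) (llabel R m2) (llabel R m3) (signed_arrows R m1 m2) (signed_arrows R m1 m3)"
      using cond unfolding triangle_conditions_def V_def[symmetric] by (elim bexE exE conjE) (rule that)
    then show ?thesis
      using calculation(1)[of m1 m2 m3] by (simp add: arrows V)
  qed
  ultimately show ?thesis
    unfolding R_def V_def by blast
qed

end
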